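(* Let $k\ge 2$ be a fixed integer. For odd prime powers $q$, the number of induced copies of EPOs in the Paley $k$-graph $P_k(q)$ satisfies $$N^*_{P_k(q)}(\mathcal{O}_k^e)=\frac{q^{2k}}{2}+O(q^{2k-1}),$$ where the implied constant depends only on $k$. In particular, the family of Paley $k$-graphs $\{P_k(q): q \text{ an odd prime power}\}$ is quasi-random.
   Context: For an odd prime power $q$, the Paley (sum) $k$-graph $P_k(q)$ is the $k$-uniform hypergraph whose vertex set is the finite field $\mathbb{F}_q$, in which a $k$-element subset $\{u_1,\ldots,u_k\}$ is an edge if and only if $u_1+u_2+\cdots+u_k$ is a square in $\mathbb{F}_q$ ($0$ counts as a square). Even partial octahedra: the $k$-octahedron $\mathcal{O}_k$ is the $k$-uniform hypergraph on the $2k$ vertices $u_i(\varepsilon)$, $1\le i\le k$, $\varepsilon\in\{0,1\}$, whose edges are the $2^k$ sets $\{u_1(\varepsilon_1),\ldots,u_k(\varepsilon_k)\}$ with $\varepsilon_1,\ldots,\varepsilon_k\in\{0,1\}$. An even partial octahedron (EPO) is a $k$-uniform hypergraph on the same vertex set as $\mathcal{O}_k$ whose edge set meets the edge set of $\mathcal{O}_k$ in an even number of edges. $\mathcal{O}_k^e$ is the set of all EPOs on this vertex set. For $k$-uniform hypergraphs $G,H$, $N^*_G(H)$ is the number of labeled occurrences of $H$ as an induced subgraph of $G$ (i.e. injective maps $V(H)\to V(G)$ under which a $k$-subset of $V(H)$ is an edge of $H$ iff its image is an edge of $G$), and $N^*_G(\mathcal{O}_k^e)=\sum_{H\in\mathcal{O}_k^e}N^*_G(H)$.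 Thus $N^*_G(\mathcal{O}_k^e)$ is the number of $2k$-tuples of distinct vertices $(u_1(0),u_1(1),\ldots,u_k(0),u_k(1))$ of $G$ such that an even number of the $2^k$ sets $\{u_1(\varepsilon_1),\ldots,u_k(\varepsilon_k)\}$ are edges of $G$. Quasi-random: a family $\mathcal{G}$ of $k$-uniform hypergraphs with unbounded number of vertices is quasi-random if $N^*_G(\mathcal{O}_k^e)\le (1+o(1))\frac{n^{2k}}{2}$ for $G\in\mathcal{G}$ as $n=|V(G)|\to\infty$ (the $o(1)$ being uniform over the members of $\mathcal{G}$ with $n$ vertices). *)

theory Defs
  imports
    "HOL-Algebra.Algebra"
    "HOL-Number_Theory.Prime_Powers"
    "HOL-Library.FuncSet"
    "HOL-Library.Infinite_Typeclass"
begin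

record 'v hypergraph =
  verts :: "'v set"
  edges :: "'v set set"

definition uniform_hypergraph :: "nat \<Rightarrow> 'v hypergraph \<Rightarrow> bool" where
  "uniform_hypergraph k G \<longleftrightarrow>
     finite (verts G) \<and> (\<forall>e\<in>edges G. e \<subseteq> verts G \<and> card e = k)"

(* The maps are taken in the extensional function space, so that each map from
   the vertices of H to the vertices of G is counted once. *)
definition induced_copies :: "nat \<Rightarrow> 'v hypergraph \<Rightarrow> 'w hypergraph \<Rightarrow> nat" where
  "induced_copies k G H =
     card {f \<in> verts H \<rightarrow>\<^sub>E verts G.
             inj_on f (verts H) \<and>
             (\<forall>S. S \<subseteq> verts H \<and> card S = k \<longrightarrow> (S \<in> edges H \<longleftrightarrow> f ` S \<in> edges G))}"

(* The vertex u_i(epsilon) is the pair (i, epsilon), with True for 1 and False for 0. *)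
definition octahedron :: "nat \<Rightarrow> (nat \<times> bool) hypergraph" where
  "octahedron k =
     \<lparr>verts = {1..k} \<times> UNIV,
      edges = {(\<lambda>i. (i, \<epsilon> i)) ` {1..k} | \<epsilon>. True}\<rparr>"

(* Edges outside the octahedron are allowed and unrestricted. *)
definition even_partial_octahedra :: "nat \<Rightarrow> (nat \<times> bool) hypergraph set" where
  "even_partial_octahedra k =
     {H. uniform_hypergraph k H \<and> verts H = verts (octahedron k) \<and>
         even (card (edges H \<inter> edges (octahedron k)))}"

lemma finite_even_partial_octahedra: "finite (even_partial_octahedra k)"
proof (rule finite_subset)
  let ?V = "verts (octahedron k)"
  show "even_partial_octahedra k \<subseteq> (\<lambda>E. \<lparr>verts = ?V, edges = E\<rparr>) ` Pow (Pow ?V)"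
  proof
    fix H assume H: "H \<in> even_partial_octahedra k"
    then have "H = \<lparr>verts = ?V, edges = edges H\<rparr>" "edges H \<in> Pow (Pow ?V)"
      by (auto simp: even_partial_octahedra_def uniform_hypergraph_def)
    then show "H \<in> (\<lambda>E. \<lparr>verts = ?V, edges = E\<rparr>) ` Pow (Pow ?V)" by blast
  qed
qed (simp add: octahedron_def)

definition epo_count :: "nat \<Rightarrow> 'v hypergraph \<Rightarrow> nat" where
  "epo_count k G = (\<Sum>H\<in>even_partial_octahedra k. induced_copies k G H)"

(* The sequence \<delta> is the o(1) term; it depends on G only through its number of vertices. *)
definition quasi_random :: "nat \<Rightarrow> 'v hypergraph set \<Rightarrow> bool" where
  "quasi_random k \<G> \<longleftrightarrow>
     (\<forall>G\<in>\<G>. uniform_hypergraph k G) \<and>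
     (\<forall>n. \<exists>G\<in>\<G>. n < card (verts G)) \<and>
     (\<exists>\<delta> :: nat \<Rightarrow> real. \<delta> \<longlonglongrightarrow> 0 \<and>
        (\<forall>G\<in>\<G>. real (epo_count k G) \<le>
           (1 + \<delta> (card (verts G))) * (real (card (verts G)) ^ (2 * k) / 2)))"

(* R is a model of the finite field with q elements.  primepow excludes 0, so
   order R = q makes the carrier finite.  Finite fields are taken with carrier inside
   an infinite type: one type then contains a copy of every finite field, so a constant
   can be uniform over all of them. *)
definition odd_finite_field :: "nat \<Rightarrow> 'a ring \<Rightarrow> bool" where
  "odd_finite_field q R \<longleftrightarrow> odd q \<and> primepow q \<and> field R \<and> order R = q"

definition paley_hypergraph :: "nat \<Rightarrow> 'a ring \<Rightarrow> 'a hypergraph" where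
  "paley_hypergraph k R =
     \<lparr>verts = carrier R,
      edges = {S. S \<subseteq> carrier R \<and> card S = k \<and>
                  (\<exists>x\<in>carrier R. (\<Oplus>\<^bsub>R\<^esub>u\<in>S. u) = x [^]\<^bsub>R\<^esub> (2::nat))}\<rparr>"

end

theory Submission
  imports Defs "HOL-Computational_Algebra.Polynomial" "HOL-Library.Cardinality" "HOL-Number_Theory.Residues"
begin

text \<open>
  Write \<open>s(u,\<epsilon>) = u\<^sub>1(\<epsilon>\<^sub>1) + \<dots> + u\<^sub>k(\<epsilon>\<^sub>k)\<close> for a labeling \<open>u\<close> of the \<open>2k\<close> vertices of the
  octahedron by field elements. A copy of an EPO is an injective labeling for which an even number
  of the \<open>2^k\<close> sums \<open>s(u,\<epsilon>)\<close> are squares, because an injective labeling pulls the Paley hypergraph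
  back to exactly one hypergraph on the octahedron's vertices (\<open>epo_count_eq_card_injections\<close>). If no
  sum vanishes, then \<open>(-1)\<close> to the number of square sums is \<open>\<Prod>\<^sub>\<epsilon> \<chi>(s(u,\<epsilon>))\<close> with the quadratic
  character \<open>\<chi>\<close>, since the number of factors is even. Non-injective labelings and labelings with a
  vanishing sum lie on a bounded number of hyperplanes, so there are \<open>O(q^(2k-1))\<close> of them, and it
  remains to show \<open>\<Sum>\<^sub>u \<Prod>\<^sub>\<epsilon> \<chi>(s(u,\<epsilon>)) = O(q^(2k-1))\<close>.

  Separating the two vertices of one class turns this sum into \<open>\<Sum>\<^sub>v (\<Sum>\<^sub>x \<Prod>\<^sub>\<epsilon> \<chi>(x + s(v,\<epsilon>)))\<^sup>2\<close>, where \<open>v\<close>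
  labels the other \<open>k - 1\<close> classes (\<open>octahedral_sum_as_squares\<close>). The inner sum is a character sum over
  the values of a product of \<open>2^(k-1)\<close> linear polynomials. It is \<open>O(\<surd>q)\<close> unless the root belonging to
  one fixed sign vector is repeated, which happens for \<open>O(q^(2k-3))\<close> labelings \<open>v\<close> only; for
  those the trivial bound \<open>q\<^sup>2\<close> of the square suffices.

  The square-root bound is the Weil bound for \<open>\<Sum>\<^sub>x \<chi>(f x)\<close>, proved by Stepanov's method for \<open>f\<close> of odd
  degree with \<open>f(0) \<noteq> 0\<close> (\<open>quad_char_sum_bound\<close>). A product of an even number of linear factors takes this
  form after the substitution \<open>x = -c + 1/y\<close>, which moves the root \<open>-c\<close> to infinity
  (\<open>quad_char_shifted_product_sum_bound\<close>). Stepanov's method looks for a nonzero polynomial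
  \<open>R = \<Sum>\<^sub>j (r\<^sub>j + s\<^sub>j f^((q-1)/2)) X^(qj)\<close> of small degree that vanishes to high order at every \<open>x\<close> with
  \<open>f(x)^((q-1)/2) = a\<close>. On these points \<open>X^q\<close> may be replaced by \<open>x\<close> and the half power by \<open>a\<close>, which lowers
  the degrees so much that vanishing costs fewer linear conditions than there are free coefficients.

  All of this is carried out for types of class \<^class>\<open>finite_field\<close>. To reach every field given by a record
  over \<open>'a\<close>, a type is defined whose elements form one field chosen as follows: it violates the
  asserted bound if any field over \<open>'a\<close> does. The bound on this type then gives the bound everywhere.
\<close>

hide_const (open) UnivPoly.coeff UnivPoly.monom Coset.order Polynomials.degree Divisibility.prime

section \<open>The quadratic character of a finite field\<close>
lemma card_eq_CHAR_power:
  assumes "primepow CARD('a::finite_field)"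
  obtains n where "CARD('a) = CHAR('a) ^ n"
proof -
  obtain p n where pn: "prime p" "CARD('a) = p ^ n"
    using assms by (auto simp: primepow_def)
  have "CHAR('a) dvd p ^ n"
    using CHAR_dvd_CARD[where 'a = 'a] pn by simp
  then have "CHAR('a) = p"
    using pn(1) CHAR_prime[where 'a='a] prime_dvd_power primes_dvd_imp_eq by blast
  with pn that show ?thesis by blast
qed

lemma two_neq_0:
  assumes "odd CARD('a::finite_field)"
  shows "(2::'a) \<noteq> 0"
proof
  assume "(2::'a) = 0"
  then have "CHAR('a) dvd 2"
    using of_nat_eq_0_iff_char_dvd[where 'a='a, of 2] by simp
  moreover have "CHAR('a) dvd CARD('a)"
    by (rule CHAR_dvd_CARD)
  ultimately show False
    using assms CHAR_prime[where 'a='a]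
    by (metis primes_dvd_imp_eq two_is_prime_nat)
qed

lemma power_card_minus_1:
  assumes "(x::'a::finite_field) \<noteq> 0"
  shows "x ^ (CARD('a) - 1) = 1"
proof -
  have "x * x ^ (CARD('a) - 1) = x * 1"
    using finite_field_power_card_eq_same[of x] finite_UNIV_card_ge_0[where 'a='a]
    by (metis One_nat_def Suc_pred finite mult.right_neutral power_Suc)
  then show ?thesis using assms by simp
qed

lemma card_ge_3:
  assumes "odd CARD('a::finite_field)"
  shows "CARD('a) \<ge> 3"
proof -
  have "card {0, 1::'a} \<le> CARD('a)" by (rule card_mono) auto
  then have "CARD('a) \<ge> 2" by simp
  then show ?thesis using assms by presburger
qed

definition quad_char :: "'a::field \<Rightarrow> int" where
  "quad_char x = (if x = 0 then 0 else if \<exists>y. x = y ^ 2 then 1 else -1)"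

lemma quad_char_0 [simp]: "quad_char 0 = 0" by (simp add: quad_char_def)
lemma quad_char_1 [simp]: "quad_char 1 = 1" 
  unfolding quad_char_def by (metis power_one zero_neq_one)

text \<open>Squaring is at most two-to-one.\<close>
lemma card_nonzero_squares:
  assumes "odd CARD('a::finite_field)"
  shows "(CARD('a) - 1) div 2 \<le> card ((\<lambda>y::'a. y ^ 2) ` (UNIV - {0}))" (is "_ \<le> card ?Q")
proof -
  have "UNIV - {0::'a} \<subseteq> (\<Union>s\<in>?Q. {y. y ^ 2 = s})" by auto
  then have "card (UNIV - {0::'a}) \<le> card (\<Union>s\<in>?Q. {y. y ^ 2 = s})"
    by (intro card_mono) auto
  also have "\<dots> \<le> (\<Sum>s\<in>?Q. card {y::'a. y ^ 2 = s})"
    by (rule card_UN_le) auto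
  also have "\<dots> \<le> (\<Sum>s\<in>?Q. 2)"
  proof (rule sum_mono)
    fix s assume "s \<in> ?Q"
    then obtain y where "s = y ^ 2" by auto
    then have "{z::'a. z ^ 2 = s} = {y, -y}" by (auto simp: power2_eq_iff)
    moreover have "card {y, -y} \<le> 2" by (simp add: card_insert_if)
    ultimately show "card {z::'a. z ^ 2 = s} \<le> 2" by simp
  qed
  finally show ?thesis by (simp add: card_Diff_subset)
qed

text \<open>
  Put \<open>n = (q - 1) / 2\<close>. The nonzero squares are at least \<open>n\<close> roots of \<open>X^n - 1\<close>, so they are all of its
  roots. At a non-square the power is therefore a square root of \<open>1\<close> other than \<open>1\<close>.
\<close>
lemma euler_criterion:
  assumes odd: "odd CARD('a::finite_field)"
  shows "(of_int (quad_char x) :: 'a) = x ^ ((CARD('a) - 1) div 2)"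
proof -
  define n where "n = (CARD('a) - 1) div 2"
  have n: "CARD('a) - 1 = 2 * n" "n > 0"
    using card_ge_3[OF odd] odd by (auto simp: n_def)
  have sq1: "y ^ (2 * n) = 1" if "y \<noteq> 0" for y :: 'a
    using power_card_minus_1[OF that] n by simp
  show ?thesis
  proof (cases "x = 0 \<or> (\<exists>y. x = y ^ 2)")
    case True
    then show ?thesis
      using n sq1 by (auto simp: quad_char_def n_def[symmetric] power_mult[symmetric])
  next
    case False
    have "x ^ n \<noteq> 1"
    proof
      assume xn: "x ^ n = 1"
      define p where "p = monom (1::'a) n - 1"
      let ?Q = "(\<lambda>y::'a. y ^ 2) ` (UNIV - {0})"
      have p0: "p \<noteq> 0"
      proof
        assume "p = 0"
        then have "poly p 0 = 0" by simp
        then show False using n by (simp add: p_def poly_monom zero_power)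
      qed
      have "insert x ?Q \<subseteq> {z. poly p z = 0}"
        using xn sq1 by (auto simp: p_def poly_monom power_mult[symmetric])
      then have "card (insert x ?Q) \<le> card {z. poly p z = 0}"
        by (intro card_mono) auto
      also have "\<dots> \<le> degree p"
        by (intro card_poly_roots_bound p0)
      also have "\<dots> \<le> n"
        unfolding p_def by (intro degree_diff_le) (auto simp: degree_monom_le)
      finally have "card (insert x ?Q) \<le> n" .
      moreover have "x \<notin> ?Q" using False by auto
      ultimately show False
        using card_nonzero_squares[OF odd] by (simp add: n_def)
    qed
    moreover have "(x ^ n) ^ 2 = 1"
      using sq1[of x] False by (simp add: power_mult[symmetric] mult.commute)
    ultimately have "x ^ n = -1" by (simp add: power2_eq_1_iff)
    then show ?thesis using False by (simp add: quad_char_def n_def)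
  qed
qed

lemma quad_char_cases: "quad_char x \<in> {-1, 0, 1}"
  by (simp add: quad_char_def)

lemma abs_quad_char_le_1: "\<bar>quad_char x\<bar> \<le> 1"
  by (simp add: quad_char_def)

text \<open>
  Identities between character values can be checked in the field, where Euler's criterion
  makes the character a power map.
\<close>
lemma of_int_sign_inj:
  assumes "odd CARD('a::finite_field)" "a \<in> {-1, 0, 1}" "b \<in> {-1, 0, 1}"
    "(of_int a :: 'a) = of_int b"
  shows "a = b"
proof -
  have "(1::'a) \<noteq> -1"
    using two_neq_0[OF assms(1)] by (metis eq_neg_iff_add_eq_0 one_add_one)
  then have "(-1::'a) \<noteq> 1" by metis
  with \<open>(1::'a) \<noteq> -1\<close> show ?thesis
    using assms(2-4) by (elim insertE emptyE) simp_all
qed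

lemma quad_char_mult:
  assumes odd: "odd CARD('a::finite_field)"
  shows "quad_char (x * y :: 'a) = quad_char x * quad_char y"
proof (rule of_int_sign_inj[OF odd])
  show "quad_char x * quad_char y \<in> {-1, 0, 1}"
    using quad_char_cases[of x] quad_char_cases[of y] by auto
qed (use quad_char_cases in \<open>auto simp: euler_criterion[OF odd] power_mult_distrib\<close>)

lemma quad_char_prod:
  assumes odd: "odd CARD('a::finite_field)"
  shows "quad_char (\<Prod>i\<in>I. f i :: 'a) = (\<Prod>i\<in>I. quad_char (f i))"
  by (induction I rule: infinite_finite_induct) (auto simp: quad_char_mult[OF odd])

section \<open>Taylor shifts along a polynomial\<close>

text \<open>
  This is \<open>p(X + f(X) T)\<close> as a polynomial in \<open>T\<close> over \<open>'a[X]\<close>. Its coefficient at \<open>T^k\<close> is \<open>f^k\<close>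
  times the \<open>k\<close>-th Hasse derivative of \<open>p\<close>, so it detects multiple zeros of any order also in positive
  characteristic. The step \<open>f(X) T\<close> instead of \<open>T\<close> is chosen so that \<open>f\<close> divides the shift of \<open>f\<close>.
\<close>
definition shift_poly :: "'a::comm_ring_1 poly \<Rightarrow> 'a poly \<Rightarrow> 'a poly poly" where
  "shift_poly f p = poly (map_poly (\<lambda>a. [:[:a:]:]) p) [:[:0, 1:], f:]"

lemma shift_poly_0 [simp]: "shift_poly f 0 = 0"
  by (simp add: shift_poly_def)

lemma shift_poly_pCons:
  "shift_poly f (pCons a p) = [:[:a:]:] + [:[:0, 1:], f:] * shift_poly f p"
  by (simp add: shift_poly_def map_poly_pCons)

lemma shift_poly_const: "shift_poly f [:a:] = [:[:a:]:]"
  by (simp add: shift_poly_pCons)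

lemma shift_poly_add: "shift_poly f (p + q) = shift_poly f p + shift_poly f q"
proof (induction p q rule: poly_induct2)
  case 0
  then show ?case by simp
next
  case (pCons a p b q)
  have "shift_poly f (pCons a p + pCons b q)
      = [:[:a:]:] + [:[:b:]:] + [:[:0, 1:], f:] * (shift_poly f p + shift_poly f q)"
    by (simp add: shift_poly_pCons pCons.IH del: mult_pCons_left mult_pCons_right)
  then show ?case
    by (simp add: shift_poly_pCons algebra_simps del: mult_pCons_left mult_pCons_right add_pCons)
qed

lemma shift_poly_smult: "shift_poly f (smult c p) = [:[:c:]:] * shift_poly f p"
  by (induction p) (simp_all add: shift_poly_pCons algebra_simps)

lemma shift_poly_mult: "shift_poly f (p * q) = shift_poly f p * shift_poly f q"
  by (induction p)
    (simp_all add: shift_poly_pCons shift_poly_add shift_poly_smult algebra_simps)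

lemma shift_poly_1: "shift_poly f 1 = 1"
  using shift_poly_const[of f 1] by (simp add: one_pCons)

lemma shift_poly_power: "shift_poly f (p ^ n) = shift_poly f p ^ n"
  by (induction n) (simp_all add: shift_poly_1 shift_poly_mult)

lemma shift_poly_sum: "shift_poly f (sum p I) = (\<Sum>i\<in>I. shift_poly f (p i))"
  by (induction I rule: infinite_finite_induct) (simp_all add: shift_poly_add)

lemma shift_poly_X: "shift_poly f [:0, 1:] = [:[:0, 1:], f:]"
  by (simp add: shift_poly_pCons one_pCons)

text \<open>
  Each power of \<open>T\<close> may raise the degree in \<open>X\<close> by \<open>e\<close>. With \<open>e = deg f - 1\<close> this is how
  shifting along \<open>f\<close> changes degrees.
\<close>
definition weighted :: "nat \<Rightarrow> nat \<Rightarrow> 'a::comm_ring_1 poly poly \<Rightarrow> bool" where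
  "weighted e c P \<longleftrightarrow> (\<forall>i. degree (coeff P i) \<le> c + e * i)"

lemma weighted_add: "weighted e c P \<Longrightarrow> weighted e c Q \<Longrightarrow> weighted e c (P + Q)"
  by (simp add: weighted_def degree_add_le)

lemma weighted_mono: "weighted e c P \<Longrightarrow> c \<le> d \<Longrightarrow> weighted e d P"
  unfolding weighted_def by (meson add_le_mono1 le_trans)

lemma weighted_const: "degree p \<le> c \<Longrightarrow> weighted e c [:p:]"
  by (auto simp: weighted_def coeff_pCons split: nat.splits)

lemma weighted_mult:
  assumes "weighted e c P" "weighted e d Q"
  shows "weighted e (c + d) (P * Q)"
  unfolding weighted_def
proof
  fix n
  show "degree (coeff (P * Q) n) \<le> c + d + e * n"
    unfolding coeff_mult
  proof (rule degree_sum_le)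
    fix i assume i: "i \<in> {..n}"
    have "degree (coeff P i * coeff Q (n - i))
        \<le> (c + e * i) + (d + e * (n - i))"
      using assms unfolding weighted_def by (meson add_mono degree_mult_le le_trans)
    also have "\<dots> = c + d + e * (i + (n - i))" by (simp add: algebra_simps)
    also have "i + (n - i) = n" using i by simp
    finally show "degree (coeff P i * coeff Q (n - i))
        \<le> c + d + e * n" .
  qed simp
qed

lemma weighted_power: "weighted e 0 P \<Longrightarrow> weighted e 0 (P ^ n)"
proof (induction n)
  case 0
  then show ?case using weighted_const[of 1 0 e] by (simp add: one_pCons)
next
  case (Suc n)
  then show ?case using weighted_mult[of e 0 P 0 "P ^ n"] by simp
qed

lemma weighted_sum:
  "(\<And>i. i \<in> I \<Longrightarrow> weighted e c (P i)) \<Longrightarrow> weighted e c (sum P I)"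
proof (induction I rule: infinite_finite_induct)
  case (insert i I)
  then show ?case by (simp add: weighted_add)
qed (simp_all add: weighted_def)

lemma weighted_shift_poly:
  assumes "degree f \<le> Suc e"
  shows "weighted e (degree p) (shift_poly f p)"
proof (induction p)
  case 0
  then show ?case by (simp add: weighted_def)
next
  case (pCons a p)
  have Z: "weighted e 1 [:[:0, 1:], f:]"
    using assms by (auto simp: weighted_def coeff_pCons split: nat.splits)
  show ?case
  proof (cases "p = 0")
    case True
    then show ?thesis by (simp add: shift_poly_const weighted_const)
  next
    case False
    then show ?thesis
      using weighted_mult[OF Z pCons.IH]
      by (auto simp: shift_poly_pCons intro!: weighted_add weighted_const)
  qed
qed

text \<open>The increment of \<open>p\<close> between \<open>X\<close> and \<open>X + f T\<close> is divisible by the step \<open>f T\<close>.\<close>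
lemma shift_poly_first_order:
  "\<exists>G. shift_poly f p = [:p:] + [:0, f:] * G"
proof (induction p)
  case 0
  then show ?case by (intro exI[of _ 0]) simp
next
  case (pCons a p)
  then obtain G where G: "shift_poly f p = [:p:] + [:0, f:] * G" by blast
  have split: "[:[:0, 1:], f:] = [:[:0, 1:]:] + [:0, f:]" by simp
  have "[:pCons a p:] = [:[:a:]:] + [:[:0, 1:]:] * [:p:]"
    by simp
  then have "shift_poly f (pCons a p) = [:pCons a p:] + [:0, f:] * ([:p:] + [:[:0, 1:], f:] * G)"
    unfolding shift_poly_pCons G by (simp add: split algebra_simps del: mult_pCons_left mult_pCons_right add_pCons)
  then show ?case by blast
qed

text \<open>
  Since \<open>f\<close> factors out, the shift of any power \<open>f^n\<close> is \<open>f^n W^n\<close>, and \<open>W^n\<close> has weight \<open>0\<close>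
  however large \<open>n\<close> is. This keeps the half power \<open>f^((q-1)/2)\<close> from spoiling the degree count.
\<close>
lemma shift_poly_self:
  fixes f :: "'a::idom poly"
  assumes "degree f = Suc e"
  obtains W where "shift_poly f f = [:f:] * W" "weighted e 0 W"
proof -
  obtain G where G: "shift_poly f f = [:f:] + [:0, f:] * G"
    using shift_poly_first_order by blast
  define W where "W = pCons 1 G"
  have 1: "shift_poly f f = [:f:] * W" by (simp add: G W_def)
  have "degree (coeff W i) \<le> e * i" for i
  proof (cases "coeff W i = 0 \<or> i = 0")
    case True
    then show ?thesis by (auto simp: W_def)
  next
    case False
    have "f \<noteq> 0" using assms by auto
    have "degree (coeff (shift_poly f f) i) \<le> Suc e + e * i"
      using weighted_shift_poly[of f e f] assms by (simp add: weighted_def)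
    moreover have "coeff (shift_poly f f) i = f * coeff W i"
      by (simp add: 1)
    ultimately show ?thesis
      using False \<open>f \<noteq> 0\<close> assms by (simp add: degree_mult_eq)
  qed
  then have "weighted e 0 W" by (simp add: weighted_def)
  with 1 that show ?thesis by blast
qed

lemma eval_shift_poly:
  fixes f :: "'a::comm_ring_1 poly"
  shows "map_poly (\<lambda>p. poly p x) (shift_poly f r) = pcompose r [:x, poly f x:]"
proof (induction r)
  case 0
  then show ?case by simp
next
  case (pCons a r)
  show ?case
  proof (rule poly_eqI)
    fix n
    have "coeff (pcompose r [:x, poly f x:]) i = poly (coeff (shift_poly f r) i) x" for i
      by (simp add: pCons.IH[symmetric] coeff_map_poly)
    then show "coeff (map_poly (\<lambda>p. poly p x) (shift_poly f (pCons a r))) n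
        = coeff (pcompose (pCons a r) [:x, poly f x:]) n"
      by (simp add: coeff_map_poly shift_poly_pCons pcompose_pCons coeff_pCons split: nat.splits)
  qed
qed

text \<open>
  Evaluated at \<open>x\<close>, the shift becomes \<open>r(x + f(x) T)\<close>. If it is divisible by \<open>T^l\<close>, the inverse substitution
  \<open>T = (X - x) / f(x)\<close> gives the claim.
\<close>
lemma linear_power_dvd_if_shift_poly_vanishes:
  fixes f :: "'a::field poly"
  assumes fx: "poly f x \<noteq> 0"
    and van: "\<And>k. k < l \<Longrightarrow> poly (coeff (shift_poly f r) k) x = 0"
  shows "[:- x, 1:] ^ l dvd r"
proof -
  define c where "c = poly f x"
  define M where "M = [:- x / c, 1 / c:]"
  have c: "c \<noteq> 0" using fx by (simp add: c_def)
  have "monom 1 l dvd pcompose r [:x, c:]"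
    unfolding monom_1_dvd_iff'
    using van by (simp add: c_def coeff_map_poly flip: eval_shift_poly)
  then
  obtain u where u: "pcompose r [:x, c:] = [:0, 1:] ^ l * u"
    by (auto simp: monom_altdef)
  have "pcompose [:x, c:] M = [:0, 1:]"
    using c by (simp add: M_def pcompose_pCons)
  then have "r = pcompose (pcompose r [:x, c:]) M"
    by (simp flip: pcompose_assoc)
  also have "\<dots> = M ^ l * pcompose u M"
  proof -
    have "pcompose ([:0, 1:] ^ l) M = M ^ l"
      by (induction l) (simp_all add: pcompose_mult pcompose_pCons pcompose_1)
    then show ?thesis by (simp add: u pcompose_mult)
  qed
  also have "M ^ l = smult ((1 / c) ^ l) ([:- x, 1:] ^ l)"
  proof -
    have "M = smult (1 / c) [:- x, 1:]" by (simp add: M_def)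
    then show ?thesis by (simp only: smult_power)
  qed
  finally have "r = [:- x, 1:] ^ l * (smult ((1 / c) ^ l) (pcompose u M))"
    by (simp only: mult_smult_left mult_smult_right)
  then show ?thesis by (metis dvd_triv_left)
qed

section \<open>Stepanov's auxiliary polynomial\<close>
lemma poly_power_mod_X_power:
  fixes f :: "'a::comm_ring_1 poly"
  assumes "prime CHAR('a)" "q = CHAR('a) ^ n"
  obtains H where "f ^ q = [:poly f 0 ^ q:] + [:0, 1:] ^ q * H"
proof -
  obtain a h where f: "f = pCons a h" by (cases f)
  have "f = [:a:] + [:0, 1:] * h" by (simp add: f)
  then have "f ^ q = [:a:] ^ q + ([:0, 1:] * h) ^ q"
    using freshmans_dream'[of q n "[:a:]" "[:0, 1:] * h"] assms by simp
  then have "f ^ q = [:poly f 0 ^ q:] + [:0, 1:] ^ q * h ^ q"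
    by (simp only: f poly_const_pow power_mult_distrib) simp
  then show ?thesis using that by blast
qed

text \<open>
  Suppose that the sum vanishes. Multiplying \<open>\<Sum>\<^sub>j r\<^sub>j X^(qj) = - f^((q-1)/2) \<Sum>\<^sub>j s\<^sub>j X^(qj)\<close> by itself and by \<open>f\<close>
  replaces the half power by \<open>f^q\<close>, which is the constant \<open>c = f(0)^q\<close> modulo \<open>X^q\<close>. Hence
  \<open>r\<^sub>0\<^sup>2 f - c s\<^sub>0\<^sup>2\<close> is divisible by \<open>X^q\<close>; its degree is below \<open>q\<close>, so it is zero, and the odd degree of \<open>f\<close>
  forces \<open>r\<^sub>0 = s\<^sub>0 = 0\<close>. Cancelling \<open>X^q\<close> leaves a shorter sum of the same form.
\<close>
lemma auxiliary_poly_nonzero: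
  fixes f :: "'a::field poly" and r s :: "nat \<Rightarrow> 'a poly"
  assumes q: "prime CHAR('a)" "q = CHAR('a) ^ n" "odd q"
    and f: "odd (degree f)" "poly f 0 \<noteq> 0"
    and B: "2 * B + degree f < q"
  shows "\<lbrakk>\<And>j. degree (r j) \<le> B; \<And>j. degree (s j) \<le> B;
          (\<Sum>j<J. (r j + s j * f ^ ((q - 1) div 2)) * [:0, 1:] ^ (q * j)) = 0; j < J\<rbrakk>
         \<Longrightarrow> r j = 0 \<and> s j = 0"
proof (induction J arbitrary: r s j)
  case 0
  then show ?case by simp
next
  case (Suc J)
  define g where "g = f ^ ((q - 1) div 2)"
  define Y where "Y = [:0, 1::'a:]"
  define R where "R = (\<Sum>j<J. r (Suc j) * Y ^ (q * j))"
  define S where "S = (\<Sum>j<J. s (Suc j) * Y ^ (q * j))"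
  define c where "c = poly f 0 ^ q"
  obtain H where H: "f ^ q = [:c:] + Y ^ q * H"
    using poly_power_mod_X_power[OF q(1,2), of f] unfolding c_def Y_def by blast
  have tail: "(\<Sum>j<J. (r (Suc j) + s (Suc j) * g) * Y ^ (q * j)) = R + S * g"
    by (simp add: R_def S_def sum_distrib_left sum_distrib_right sum.distrib algebra_simps)
  have "0 = (\<Sum>j<Suc J. (r j + s j * g) * Y ^ (q * j))"
    using Suc.prems(3) by (simp add: g_def Y_def)
  also have "\<dots> = (r 0 + s 0 * g) + Y ^ q * (R + S * g)"
    unfolding tail[symmetric]
    by (simp add: sum.lessThan_Suc_shift sum_distrib_left power_add mult_ac del: sum.lessThan_Suc)
  finally have eq0: "(r 0 + s 0 * g) + Y ^ q * (R + S * g) = 0" by simp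
  have fq: "f * g ^ 2 = f ^ q"
  proof -
    have "q = Suc (2 * ((q - 1) div 2))" using q(3) by presburger
    then have "f ^ q = f * f ^ (2 * ((q - 1) div 2))" by (metis power_Suc)
    then show ?thesis by (simp add: g_def power_mult[symmetric] mult.commute)
  qed
  have "r 0 + Y ^ q * R = - ((s 0 + Y ^ q * S) * g)"
    using eq0 by (simp add: algebra_simps eq_neg_iff_add_eq_0)
  then have "(r 0 + Y ^ q * R) ^ 2 * f = (s 0 + Y ^ q * S) ^ 2 * (f * g ^ 2)"
    by (simp add: power_mult_distrib)
  then have "(r 0 + Y ^ q * R) ^ 2 * f = (s 0 + Y ^ q * S) ^ 2 * ([:c:] + Y ^ q * H)"
    by (simp only: fq H)
  moreover have "a ^ 2 * F - b ^ 2 * C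
        = y * ((b + y * t) ^ 2 * h + (2 * b * t + y * t ^ 2) * C - (2 * a * u + y * u ^ 2) * F)"
    if "(a + y * u) ^ 2 * F = (b + y * t) ^ 2 * (C + y * h)" for a b C F h t u y :: "'a poly"
  proof -
    have sq: "(w + y * z) ^ 2 = w ^ 2 + y * (2 * w * z + y * z ^ 2)" for w z :: "'a poly"
      by (simp only: power2_sum power_mult_distrib distrib_left) (simp add: power2_eq_square mult_ac)
    have sqC: "(b + y * t) ^ 2 * C = b ^ 2 * C + y * (2 * b * t + y * t ^ 2) * C"
      by (simp only: sq distrib_right)
    have "a ^ 2 * F + y * (2 * a * u + y * u ^ 2) * F
        = b ^ 2 * C + y * (2 * b * t + y * t ^ 2) * C + (b + y * t) ^ 2 * (y * h)"
      using that unfolding distrib_left[of "(b + y * t) ^ 2"] sq[of a u] sqC distrib_right[of _ _ F] .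
    moreover have "w - z = v + x - p" if "w + p = z + v + x" for w p z v x :: "'a poly"
    proof -
      have "w = z + v + x - p" by (simp only: eq_diff_eq that)
      then show ?thesis by simp
    qed
    ultimately have "a ^ 2 * F - b ^ 2 * C
        = y * (2 * b * t + y * t ^ 2) * C + (b + y * t) ^ 2 * (y * h)
          - y * (2 * a * u + y * u ^ 2) * F"
      by blast
    moreover have "y * v * C + p * (y * h) - y * w * F = y * (p * h + v * C - w * F)"
      for p v w :: "'a poly"
      by (simp only: right_diff_distrib distrib_left mult.assoc mult.left_commute[of p y]
          add.commute[of "y * (p * h)"])
    ultimately show ?thesis by (simp only:)
  qed
  ultimately have "(r 0) ^ 2 * f - (s 0) ^ 2 * [:c:] = Y ^ q * ((s 0 + Y ^ q * S) ^ 2 * H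
      + (2 * s 0 * S + Y ^ q * S ^ 2) * [:c:] - (2 * r 0 * R + Y ^ q * R ^ 2) * f)"
    by blast
  then have dvd: "Y ^ q dvd (r 0) ^ 2 * f - (s 0) ^ 2 * [:c:]" by (metis dvd_triv_left)
  have sq_deg: "degree (p ^ 2) \<le> 2 * B" if "degree p \<le> B" for p :: "'a poly"
    using that degree_power_le[of p 2] by linarith
  have "degree ((r 0) ^ 2 * f - (s 0) ^ 2 * [:c:]) < q"
  proof -
    have "degree ((r 0) ^ 2 * f) \<le> 2 * B + degree f"
      using degree_mult_le[of "(r 0) ^ 2" f] sq_deg[OF Suc.prems(1), of 0] by linarith
    moreover have "degree ((s 0) ^ 2 * [:c:]) \<le> 2 * B + 0"
      using degree_mult_le[of "(s 0) ^ 2" "[:c:]"] sq_deg[OF Suc.prems(2), of 0] by simp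
    ultimately have "degree ((r 0) ^ 2 * f - (s 0) ^ 2 * [:c:]) \<le> 2 * B + degree f"
      by (intro degree_diff_le) auto
    then show ?thesis using B by simp
  qed
  moreover have "degree (Y ^ q) = q" by (simp add: Y_def degree_power_eq)
  ultimately have eq: "(r 0) ^ 2 * f = (s 0) ^ 2 * [:c:]"
    using dvd_imp_degree_le[OF dvd] by force
  have c0: "c \<noteq> 0" using f by (simp add: c_def)
  have f0: "f \<noteq> 0" using f by auto
  have r0: "r 0 = 0"
  proof (rule ccontr)
    assume "r 0 \<noteq> 0"
    moreover from this have "s 0 \<noteq> 0" using eq f0 by auto
    ultimately have "2 * degree (r 0) + degree f = 2 * degree (s 0)"
      using arg_cong[OF eq, of degree] c0 f0
      by (simp add: degree_mult_eq degree_power_eq)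
    then have "even (2 * degree (r 0) + degree f)" by simp
    then show False using f(1) by simp
  qed
  then have s0: "s 0 = 0" using eq c0 by auto
  have "Y ^ q * (R + S * g) = 0" using eq0 r0 s0 by simp
  moreover have "Y ^ q \<noteq> 0" by (simp add: Y_def)
  ultimately have "R + S * g = 0" using mult_eq_0_iff by blast
  then have "(\<Sum>j<J. (r (Suc j) + s (Suc j) * g) * Y ^ (q * j)) = 0" using tail by simp
  then have rest: "(\<Sum>j<J. (r (Suc j) + s (Suc j) * f ^ ((q - 1) div 2)) * [:0, 1:] ^ (q * j)) = 0"
    by (simp only: g_def Y_def)
  have "r (Suc i) = 0 \<and> s (Suc i) = 0" if "i < J" for i
    by (rule Suc.IH[of "\<lambda>j. r (Suc j)" "\<lambda>j. s (Suc j)", OF Suc.prems(1,2) rest that])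
  then show ?case using r0 s0 Suc.prems(4) by (cases j) auto
qed

text \<open>
  The linear algebra over a finite field is done by counting: a map from a larger space of polynomials
  to a smaller one is not injective.
\<close>
lemma card_poly_coeffs_below:
  "card {p::'a::finite_field poly. \<forall>i\<ge>n. coeff p i = 0} = CARD('a) ^ n"
  "finite {p::'a::finite_field poly. \<forall>i\<ge>n. coeff p i = 0}"
proof -
  let ?P = "{p::'a poly. \<forall>i\<ge>n. coeff p i = 0}"
  have coeff_monoms: "coeff (\<Sum>i<n. monom (h i) i) k = (if k < n then h k else 0)" for h :: "nat \<Rightarrow> 'a" and k
    by (simp add: coeff_sum)
  have bij: "bij_betw (\<lambda>p. restrict (coeff p) {..<n}) ?P ({..<n} \<rightarrow>\<^sub>E UNIV)"
  proof (rule bij_betw_byWitness[where f' = "\<lambda>h. \<Sum>i<n. monom (h i) i"])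
    show "\<forall>p\<in>?P. (\<Sum>i<n. monom (restrict (coeff p) {..<n} i) i) = p"
      by (auto intro!: poly_eqI simp: coeff_monoms)
    show "\<forall>h\<in>{..<n} \<rightarrow>\<^sub>E (UNIV :: 'a set). restrict (coeff (\<Sum>i<n. monom (h i) i)) {..<n} = h"
    proof (intro ballI ext)
      fix h :: "nat \<Rightarrow> 'a" and x
      assume "h \<in> {..<n} \<rightarrow>\<^sub>E UNIV"
      then show "restrict (coeff (\<Sum>i<n. monom (h i) i)) {..<n} x = h x"
        by (cases "x < n") (simp_all add: coeff_monoms PiE_arb[of h])
    qed
    show "(\<lambda>p. restrict (coeff p) {..<n}) ` ?P \<subseteq> {..<n} \<rightarrow>\<^sub>E UNIV"
      by (intro image_subsetI) (simp only: restrict_PiE_iff, simp)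
    show "(\<lambda>h. \<Sum>i<n. monom (h i) i) ` ({..<n} \<rightarrow>\<^sub>E UNIV) \<subseteq> ?P"
      by (intro image_subsetI) (simp add: coeff_monoms)
  qed
  show "card ?P = CARD('a) ^ n"
    using bij_betw_same_card[OF bij] by (simp add: card_funcsetE)
  show "finite ?P"
    using bij_betw_finite[OF bij] by (simp add: finite_PiE)
qed

lemma diff_dvd_power_diff: "(x - y :: 'a::comm_ring_1) dvd x ^ n - y ^ n"
proof (induction n)
  case (Suc n)
  have "x ^ Suc n - y ^ Suc n = (x - y) * x ^ n + y * (x ^ n - y ^ n)"
    by (simp add: algebra_simps)
  then show ?case using Suc by (metis dvd_add dvd_mult dvd_triv_left)
qed simp

lemma coeff_mult_monom_below: "k < q \<Longrightarrow> coeff (P * (monom 1 q * Q)) k = (0::'a::comm_ring_1)"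
proof -
  assume "k < q"
  have "monom 1 q dvd P * (monom 1 q * Q)" by (metis dvd_triv_left mult.left_commute)
  with \<open>k < q\<close> show ?thesis using monom_1_dvd_iff' by blast
qed

text \<open>
  The coefficients of the auxiliary polynomial \<open>R\<close> form a space of dimension \<open>2J(B+1)\<close>. At a point \<open>x\<close> with
  \<open>f(x)^((q-1)/2) = a\<close>, the \<open>l\<close> lowest coefficients of the shift of \<open>R\<close> are values of \<open>l\<close> polynomials of degree
  below \<open>B + J + e l\<close> that depend linearly on \<open>R\<close> but not on the point. So fewer
  than \<open>2J(B+1)\<close> conditions make \<open>R\<close> vanish to order \<open>l\<close> at all these points, and the number
  of zeros of \<open>R\<close> is at most its degree.
\<close>
lemma stepanov_bound:
  fixes f :: "'a::finite_field poly" and a :: 'a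
  assumes q: "q = CARD('a)" "odd q" "q = CHAR('a) ^ n"
    and f: "degree f = Suc e" "even e" "poly f 0 \<noteq> 0"
    and a: "a \<noteq> 0"
    and B: "2 * B + Suc e < q"
    and l: "0 < l" "l \<le> q"
    and J: "l * (B + J + e * l) < 2 * J * (B + 1)"
  shows "l * card {x. poly f x ^ ((q - 1) div 2) = a}
         \<le> B + Suc e * ((q - 1) div 2) + q * (J - 1)"
proof -
  define N where "N = (q - 1) div 2"
  define g where "g = f ^ N"
  define Y where "Y = [:0, 1::'a:]"
  define S where "S = {x. poly f x ^ N = a}"
  have q3: "q \<ge> 3" using card_ge_3 q by blast
  then have N: "N > 0" by (simp add: N_def)
  have J0: "J > 0" using J by (cases J) auto
  obtain W where W: "shift_poly f f = [:f:] * W" "weighted e 0 W"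
    using shift_poly_self[OF f(1)] by blast
  \<comment> \<open>The shift of \<open>f ^ N\<close> is \<open>f ^ N\<close> times \<open>V\<close>.\<close>
  define V where "V = W ^ N"
  have V: "weighted e 0 V" using W(2) by (simp add: V_def weighted_power)
  \<comment> \<open>The shift of the auxiliary polynomial with \<open>f ^ N\<close> replaced by \<open>a\<close> and \<open>Y ^ q\<close> by \<open>Y\<close>.\<close>
  define \<Phi> where "\<Phi> = (\<lambda>r s. \<Sum>j<J. (shift_poly f (r j) + smult [:a:] (V * shift_poly f (s j))) * [:Y ^ j:])"
  define Pol where "Pol = (\<lambda>n. {p::'a poly. \<forall>i\<ge>n. coeff p i = 0})"
  have Pol_degree: "p \<in> Pol (Suc n) \<longleftrightarrow> degree p \<le> n" for p n
    by (auto simp: Pol_def degree_le Suc_le_eq coeff_eq_0)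
  define U where "U = ({..<J} \<times> (UNIV::bool set)) \<rightarrow>\<^sub>E Pol (Suc B)"
  define L where "L = B + J + e * l"
  define obs where "obs = (\<lambda>u. restrict (coeff (\<Phi> (\<lambda>j. u (j, False)) (\<lambda>j. u (j, True)))) {..<l})"
  have obs_range: "obs u \<in> {..<l} \<rightarrow>\<^sub>E Pol L" if u: "u \<in> U" for u
  proof -
    have sh: "weighted e B (shift_poly f (u (j, b)))" if "j < J" for j b
    proof -
      have "degree (u (j, b)) \<le> B" using u that by (auto simp: U_def Pol_degree[symmetric])
      then show ?thesis using weighted_shift_poly[of f e "u (j, b)"] f(1) weighted_mono by fastforce
    qed
    have "weighted e (B + (J - 1)) (\<Phi> (\<lambda>j. u (j, False)) (\<lambda>j. u (j, True)))"
      unfolding \<Phi>_def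
    proof (rule weighted_sum, rule weighted_mult)
      fix j assume j: "j \<in> {..<J}"
      have "weighted e B ([:[:a:]:] * (V * shift_poly f (u (j, True))))"
        using weighted_mult[OF weighted_const[of "[:a:]" 0] weighted_mult[OF V sh[of j True]]] j by simp
      then show "weighted e B (shift_poly f (u (j, False)) + smult [:a:] (V * shift_poly f (u (j, True))))"
        using sh[of j False] j by (intro weighted_add) simp_all
      show "weighted e (J - 1) [:Y ^ j:]"
        using j by (intro weighted_const) (simp add: Y_def degree_power_eq)
    qed
    then have "degree (coeff (\<Phi> (\<lambda>j. u (j, False)) (\<lambda>j. u (j, True))) k) < L" if "k < l" for k
    proof -
      have "degree (coeff (\<Phi> (\<lambda>j. u (j, False)) (\<lambda>j. u (j, True))) k) \<le> B + (J - 1) + e * k"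
        using \<open>weighted e (B + (J - 1)) _\<close> by (simp only: weighted_def)
      moreover have "e * k \<le> e * l" using that by simp
      ultimately show ?thesis using J0 unfolding L_def by linarith
    qed
    then show ?thesis
      by (auto simp: obs_def Pol_def intro!: coeff_eq_0 intro: less_le_trans)
  qed
  have "card (obs ` U) < card U"
  proof -
    have "obs ` U \<subseteq> {..<l} \<rightarrow>\<^sub>E Pol L" using obs_range by blast
    moreover have "finite ({..<l} \<rightarrow>\<^sub>E Pol L)"
      by (intro finite_PiE) (simp_all add: Pol_def card_poly_coeffs_below)
    ultimately have "card (obs ` U) \<le> card ({..<l} \<rightarrow>\<^sub>E Pol L)" by (rule card_mono[rotated])
    also have "\<dots> = q ^ (L * l)"
      by (simp add: card_funcsetE Pol_def card_poly_coeffs_below q(1) power_mult)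
    also have "\<dots> < q ^ (2 * J * (B + 1))"
      using J q3 by (intro power_strict_increasing) (simp_all add: L_def mult.commute)
    also have "\<dots> = card U"
      unfolding U_def
      by (simp add: card_funcsetE Pol_def card_poly_coeffs_below q(1) power_mult[symmetric]
          power_add[symmetric] card_cartesian_product algebra_simps)
    finally show ?thesis .
  qed
  then have "\<not> inj_on obs U" by (rule pigeonhole)
  then obtain u v where uv: "u \<in> U" "v \<in> U" "u \<noteq> v" "obs u = obs v"
    by (auto simp: inj_on_def)
  \<comment> \<open>The difference of two coefficient vectors with the same image lies in the kernel.\<close>
  define r where "r = (\<lambda>j. if j < J then u (j, False) - v (j, False) else 0)"
  define s where "s = (\<lambda>j. if j < J then u (j, True) - v (j, True) else 0)"
  have deg_uv: "degree (u (j, b)) \<le> B" "degree (v (j, b)) \<le> B" if "j < J" for j b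
    using uv(1,2) that by (auto simp: U_def Pol_degree[symmetric])
  have rs_deg: "degree (r j) \<le> B" "degree (s j) \<le> B" for j
    using deg_uv[of j] by (auto simp: r_def s_def intro!: degree_diff_le)
  obtain j0 b0 where j0: "j0 < J" "u (j0, b0) \<noteq> v (j0, b0)"
  proof -
    have "\<exists>y\<in>{..<J} \<times> UNIV. u y \<noteq> v y"
      using uv(1-3) PiE_ext unfolding U_def by blast
    then show ?thesis using that by auto
  qed
  have \<Phi>_diff: "\<Phi> r s = \<Phi> (\<lambda>j. u (j, False)) (\<lambda>j. u (j, True)) - \<Phi> (\<lambda>j. v (j, False)) (\<lambda>j. v (j, True))"
  proof -
    have sd: "shift_poly f (p - p') = shift_poly f p - shift_poly f p'" for p p'
      using shift_poly_add[of f "p - p'" p'] by simp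
    show ?thesis
      unfolding \<Phi>_def sum_subtractf[symmetric]
      by (intro sum.cong refl) (simp add: r_def s_def sd smult_diff_right algebra_simps del: mult_pCons_left mult_pCons_right)
  qed
  have \<Phi>_0: "coeff (\<Phi> r s) k = 0" if "k < l" for k
    using fun_cong[OF uv(4), of k] that by (simp add: obs_def \<Phi>_diff)
  define R where "R = (\<Sum>j<J. (r j + s j * g) * Y ^ (q * j))"
  have R0: "R \<noteq> 0"
  proof
    assume "R = 0"
    then have "r j0 = 0 \<and> s j0 = 0"
      using auxiliary_poly_nonzero[of q n f B r s J j0] q f B rs_deg j0(1)
      by (simp add: R_def g_def N_def Y_def)
    then show False using j0 by (cases b0) (auto simp: r_def s_def)
  qed
  have deg_R: "degree R \<le> B + Suc e * N + q * (J - 1)"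
    unfolding R_def
  proof (intro degree_sum_le)
    fix j assume j: "j \<in> {..<J}"
    have g: "degree g \<le> Suc e * N" using degree_power_le[of f N] f(1) by (simp add: g_def)
    have "degree (s j * g) \<le> B + Suc e * N"
      using degree_mult_le[of "s j" g] rs_deg(2)[of j] g by linarith
    then have "degree (r j + s j * g) \<le> B + Suc e * N"
      using rs_deg(1)[of j] by (intro degree_add_le) auto
    moreover have "degree (Y ^ (q * j)) \<le> q * (J - 1)"
    proof -
      have "j \<le> J - 1" using j by auto
      then have "q * j \<le> q * (J - 1)" by (rule mult_le_mono2)
      moreover have "degree (Y ^ (q * j)) = q * j" by (simp add: Y_def degree_power_eq)
      ultimately show ?thesis by simp
    qed
    ultimately show "degree ((r j + s j * g) * Y ^ (q * j)) \<le> B + Suc e * N + q * (J - 1)"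
      using degree_mult_le[of "r j + s j * g" "Y ^ (q * j)"] by linarith
  qed simp
  have dvd_R: "[:- x, 1:] ^ l dvd R" if x: "x \<in> S" for x
  proof (rule linear_power_dvd_if_shift_poly_vanishes[where f = f])
    show "poly f x \<noteq> 0" using x a N by (auto simp: S_def)
    fix k assume k: "k < l"
    let ?Z = "[:Y, f:]"
    have sg: "shift_poly f g = [:g:] * V"
      by (simp only: g_def V_def shift_poly_power W(1) power_mult_distrib poly_const_pow)
    \<comment> \<open>Modulo \<open>T ^ q\<close>, shifting does not change \<open>Y ^ q\<close>; this is why \<open>l \<le> q\<close> is assumed.\<close>
    have Zq: "?Z ^ q = [:Y ^ q:] + monom (f ^ q) q"
    proof -
      have "?Z = [:Y:] + monom f 1" by (simp add: monom_altdef)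
      then have "?Z ^ q = [:Y:] ^ q + monom f 1 ^ q"
        using freshmans_dream'[of q n "[:Y:]" "monom f 1"] q(3) by simp
      then show ?thesis by (simp add: poly_const_pow monom_power)
    qed
    have Zqj: "\<exists>Q. ?Z ^ (q * j) = [:Y ^ (q * j):] + monom 1 q * Q" for j
    proof -
      have "?Z ^ q - [:Y ^ q:] dvd (?Z ^ q) ^ j - [:Y ^ q:] ^ j" by (rule diff_dvd_power_diff)
      moreover have "?Z ^ q - [:Y ^ q:] = monom 1 q * [:f ^ q:]"
        by (simp add: Zq smult_monom)
      ultimately have "monom 1 q dvd ?Z ^ (q * j) - [:Y ^ (q * j):]"
        by (metis dvd_mult_left poly_const_pow power_mult)
      then show ?thesis by (metis dvdE add.commute diff_add_cancel)
    qed
    have coeff_at_x: "poly (coeff (shift_poly f ((r j + s j * g) * Y ^ (q * j))) k) x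
        = poly (coeff ((shift_poly f (r j) + smult [:a:] (V * shift_poly f (s j))) * [:Y ^ j:]) k) x" for j
    proof -
      obtain Q where Q: "?Z ^ (q * j) = [:Y ^ (q * j):] + monom 1 q * Q" using Zqj by blast
      define P where "P = shift_poly f (r j) + [:g:] * (V * shift_poly f (s j))"
      have "shift_poly f ((r j + s j * g) * Y ^ (q * j)) = P * ?Z ^ (q * j)"
        by (simp only: P_def shift_poly_mult shift_poly_add shift_poly_power sg Y_def shift_poly_X ac_simps)
      then have "coeff (shift_poly f ((r j + s j * g) * Y ^ (q * j))) k = coeff P k * Y ^ (q * j)"
        using coeff_mult_monom_below[of k q P Q] k l(2)
        unfolding Q distrib_left coeff_add by (simp add: mult.commute)
      moreover have "x ^ (q * j) = x ^ j"
        using finite_field_power_card_eq_same[of x] by (simp add: q(1) power_mult)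
      moreover have "poly g x = a" using x by (simp add: g_def S_def)
      ultimately show ?thesis by (simp add: P_def Y_def mult.commute)
    qed
    have "poly (coeff (shift_poly f R) k) x = poly (coeff (\<Phi> r s) k) x"
      unfolding R_def \<Phi>_def shift_poly_sum coeff_sum poly_sum by (intro sum.cong refl coeff_at_x)
    then show "poly (coeff (shift_poly f R) k) x = 0" using \<Phi>_0[OF k] by simp
  qed
  have "l * card S = (\<Sum>x\<in>S. l)" by simp
  also have "\<dots> \<le> (\<Sum>x\<in>S. order x R)"
    using dvd_R R0 order_divides by (intro sum_mono) blast
  also have "\<dots> \<le> (\<Sum>x | poly R x = 0. order x R)"
  proof (intro sum_mono2)
    show "S \<subseteq> {x. poly R x = 0}"
      using dvd_R R0 l(1) by (fastforce simp: order_divides order_root)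
  qed auto
  also have "\<dots> \<le> degree R" by (rule sum_order_le_degree[OF R0])
  finally show ?thesis using deg_R by (simp add: S_def N_def)
qed

section \<open>The square-root bound for quadratic character sums\<close>

text \<open>
  The choice \<open>l = 2t\<close> with \<open>l\<^sup>2 \<le> q\<close> needs \<open>J\<close> slightly above \<open>l / 2\<close>; the surplus \<open>c\<close> has to
  outweigh the quadratic terms in \<open>t\<close>, which are about \<open>(2m - 1) t\<^sup>2\<close> against \<open>c \<cdot> 3 t\<^sup>2 / 2\<close>.
\<close>
lemma stepanov_parameters:
  fixes q m t :: nat
  assumes "1 \<le> m" "m \<le> t" "4 * t ^ 2 \<le> q"
  defines "c \<equiv> 4 * m + 2"
  shows "2 * t * ((q - m - 1) div 2 + (t + c) + (m - 1) * (2 * t)) < 2 * (t + c) * ((q - m - 1) div 2 + 1)"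
proof -
  define b where "b = (q - m - 1) div 2 + 1"
  obtain e where e: "m = Suc e" using assms(1) by (cases m) auto
  have "t \<le> t ^ 2" by (simp add: power2_eq_square)
  then have "m \<le> q" using assms by linarith
  then have b: "q \<le> 2 * b + m" by (auto simp: b_def)
  then have b2: "3 * t ^ 2 \<le> 2 * b" using assms \<open>t \<le> t ^ 2\<close> by linarith
  have "c * (3 * t ^ 2) \<le> c * (2 * b)" using b2 by (rule mult_le_mono2)
  then have "3 * (c * t ^ 2) \<le> 2 * (c * b)" by (simp only: mult_ac)
  moreover have "c * t \<le> c * t ^ 2" using \<open>t \<le> t ^ 2\<close> by (rule mult_le_mono2)
  moreover have "c * t ^ 2 = 4 * (e * t ^ 2) + 6 * t ^ 2" by (simp add: c_def e algebra_simps)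
  moreover have "0 < t ^ 2" using assms by simp
  moreover have "t * (t + c + 2 * e * t) = t ^ 2 + c * t + 2 * (e * t ^ 2)"
    by (simp add: power2_eq_square algebra_simps)
  ultimately have key: "t * (t + c + 2 * e * t) < c * b + t"
    by linarith
  have "2 * t * ((q - m - 1) div 2 + (t + c) + (m - 1) * (2 * t)) + 2 * t
      = 2 * (t * b) + 2 * (t * (t + c + 2 * e * t))"
    by (simp add: b_def e algebra_simps)
  also have "\<dots> < 2 * (t * b) + 2 * (c * b + t)" using key by simp
  also have "\<dots> = 2 * (t + c) * ((q - m - 1) div 2 + 1) + 2 * t"
    by (simp add: b_def algebra_simps)
  finally show ?thesis by simp
qed

text \<open>
  The degree of the auxiliary polynomial is \<open>q t + O(m q)\<close>, and each point accounts for \<open>2t\<close>, which is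
  of order \<open>\<surd>q\<close>.
\<close>
lemma card_level_set_le:
  fixes f :: "'a::finite_field poly" and a :: 'a
  assumes q: "q = CARD('a)" "odd q" "primepow q"
    and f: "odd (degree f)" "poly f 0 \<noteq> 0"
    and a: "a \<noteq> 0"
    and t: "degree f \<le> t" "2 * real t \<le> sqrt q" "sqrt q < 2 * real t + 2"
  shows "real (card {x. poly f x ^ ((q - 1) div 2) = a}) \<le> real q / 2 + 12 * real (degree f) * sqrt q"
proof -
  define m where "m = degree f"
  define A where "A = {x. poly f x ^ ((q - 1) div 2) = a}"
  define B where "B = (q - m - 1) div 2"
  define J where "J = t + (4 * m + 2)"
  obtain e where e: "m = Suc e" using f(1) by (cases m) (auto simp: m_def)
  obtain n where n: "q = CHAR('a) ^ n" using card_eq_CHAR_power q by metis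
  have m: "1 \<le> m" "m \<le> t" using e t by (auto simp: m_def)
  have "(2 * real t) ^ 2 \<le> (sqrt q) ^ 2" using t(2) by (intro power_mono) auto
  then have "real (4 * t ^ 2) \<le> real q" by (simp add: power_mult_distrib)
  then have tq: "4 * t ^ 2 \<le> q" by linarith
  have "t \<le> t ^ 2" by (simp add: power2_eq_square)
  then have "2 * t \<le> q" "m < q" using tq m by linarith+
  have "2 * t * card A \<le> B + Suc e * ((q - 1) div 2) + q * (J - 1)"
    unfolding A_def
  proof (rule stepanov_bound[where n = n])
    show "q = CARD('a)" "q = CHAR('a) ^ n" by (fact q(1), fact n)
    show "2 * B + Suc e < q" using \<open>m < q\<close> by (auto simp: B_def e)
    show "2 * t * (B + J + e * (2 * t)) < 2 * J * (B + 1)"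
      using stepanov_parameters[OF m tq] by (simp add: B_def J_def e)
    show "even e" using f(1) e by (simp add: m_def)
  qed (use q n f a e m \<open>2 * t \<le> q\<close> in \<open>auto simp: m_def\<close>)
  also have "\<dots> \<le> B + m * ((q - 1) div 2) + q * (t + 4 * m + 1)"
    by (simp add: J_def e)
  finally have "real (2 * t * card A) \<le> real (B + m * ((q - 1) div 2) + q * (t + 4 * m + 1))"
    by (rule of_nat_mono)
  moreover have "real B \<le> real q / 2"
  proof -
    have "2 * B \<le> q" by (simp add: B_def)
    then show ?thesis by linarith
  qed
  moreover have "real m * real ((q - 1) div 2) \<le> real m * (real q / 2)"
    by (intro mult_left_mono) auto
  ultimately have "2 * real t * real (card A) \<le> real q / 2 + real m * (real q / 2) + real q * (real t + 4 * real m + 1)"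
    by (simp add: algebra_simps)
  \<comment> \<open>As \<open>m \<ge> 1\<close>, adding this term rounds the coefficient of \<open>m q\<close> up to \<open>6\<close> and removes the constant.\<close>
  also have "\<dots> \<le> real q / 2 + real m * (real q / 2) + real q * (real t + 4 * real m + 1) + 1.5 * real q * (real m - 1)"
    using m by simp
  also have "\<dots> = 2 * real t * (real q / 2) + 6 * real m * real q"
    by (simp add: field_simps)
  also have "6 * real m * real q = 6 * real m * (sqrt q * sqrt q)" by simp
  also have "\<dots> \<le> 6 * real m * (sqrt q * (4 * real t))"
    using t(3) m by (intro mult_left_mono) auto
  finally have "2 * real t * real (card A) \<le> 2 * real t * (real q / 2 + 12 * real m * sqrt q)"
    by (simp add: algebra_simps)
  then show ?thesis using m by (simp add: A_def m_def)
qed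

text \<open>
  By Euler's criterion the sum is the difference of the sizes of the level sets at \<open>1\<close> and \<open>-1\<close>. Each has at
  most \<open>q / 2 + O(\<surd>q)\<close> elements, and together they miss at most \<open>m = deg f\<close> elements, so each is also at least
  \<open>q / 2 - O(\<surd>q)\<close>. If \<open>q\<close> is small compared with \<open>m\<^sup>2\<close>, the trivial bound \<open>q\<close> is good enough.
\<close>
lemma quad_char_sum_bound:
  fixes f :: "'a::finite_field poly"
  assumes q: "q = CARD('a)" "odd q" "primepow q"
    and f: "odd (degree f)" "poly f 0 \<noteq> 0"
  shows "\<bar>real_of_int (\<Sum>x\<in>UNIV. quad_char (poly f x))\<bar> \<le> 25 * real (degree f) * sqrt q"
proof -
  define N where "N = (q - 1) div 2"
  define m where "m = degree f"
  define A where "A = (\<lambda>a::'a. {x. poly f x ^ N = a})"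
  define Z where "Z = {x. poly f x = 0}"
  have m1: "m \<ge> 1" using f(1) by (cases m) (auto simp: m_def)
  have f0: "f \<noteq> 0" using f by auto
  have euler: "poly f x ^ N = of_int (quad_char (poly f x))" for x
    using euler_criterion[where 'a='a] q by (simp add: N_def)
  have iff: "poly f x ^ N = of_int b \<longleftrightarrow> quad_char (poly f x) = b" if "b \<in> {-1, 0, 1}" for b x
    using of_int_sign_inj[where 'a='a, OF _ quad_char_cases that] q by (auto simp: euler)
  have A1: "A 1 = {x. quad_char (poly f x) = 1}" using iff[of 1] by (simp add: A_def)
  have Am1: "A (-1) = {x. quad_char (poly f x) = -1}" using iff[of "-1"] by (simp add: A_def)
  have Z: "Z = {x. quad_char (poly f x) = 0}" by (auto simp: Z_def quad_char_def)
  have "(\<Sum>x\<in>UNIV. quad_char (poly f x))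
      = (\<Sum>x\<in>UNIV. of_bool (x \<in> A 1) - of_bool (x \<in> A (-1)))"
    using quad_char_cases by (intro sum.cong refl) (fastforce simp: A1 Am1)
  also have "\<dots> = int (card (A 1)) - int (card (A (-1)))"
    by (simp add: sum_subtractf)
  finally have sum: "real_of_int (\<Sum>x\<in>UNIV. quad_char (poly f x)) = real (card (A 1)) - real (card (A (-1)))"
    by simp
  have "(UNIV :: 'a set) = A 1 \<union> A (-1) \<union> Z"
    using quad_char_cases by (fastforce simp: A1 Am1 Z)
  then have "q = card (A 1 \<union> A (-1) \<union> Z)" using q by simp
  also have "\<dots> = card (A 1) + card (A (-1)) + card Z"
    by (subst card_Un_disjoint; (subst card_Un_disjoint)?) (auto simp: A1 Am1 Z)
  finally have total: "real q = real (card (A 1)) + real (card (A (-1))) + real (card Z)" by simp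
  have cZ: "real (card Z) \<le> real m"
    using card_poly_roots_bound[OF f0] by (simp add: Z_def m_def)
  have "sqrt q \<ge> 1" using card_ge_3[where 'a = 'a] q(1,2) by simp
  then have mq: "real m \<le> real m * sqrt q" using m1 by simp
  \<comment> \<open>Half the order of vanishing that Stepanov's argument asks for.\<close>
  define t where "t = nat \<lfloor>sqrt q / 2\<rfloor>"
  have "real t = of_int \<lfloor>sqrt q / 2\<rfloor>" by (simp add: t_def)
  then have t: "2 * real t \<le> sqrt q" "sqrt q < 2 * real t + 2" by linarith+
  show ?thesis
  proof (cases "m \<le> t")
    case True
    have "real (card (A a)) \<le> real q / 2 + 12 * real m * sqrt q" if "a \<noteq> 0" for a
      using card_level_set_le[OF q f that _ t] True by (simp add: A_def N_def m_def)
    note level = this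
    have "(- 1 :: 'a) \<noteq> 0" by simp
    from level[OF one_neq_zero] level[OF this] show ?thesis
      unfolding sum m_def[symmetric] abs_le_iff using total cZ mq by (intro conjI; linarith)
  next
    case False
    have "\<bar>real (card (A 1)) - real (card (A (-1)))\<bar> \<le> real q" using total by linarith
    also have "real q = sqrt q * sqrt q" by simp
    also have "\<dots> \<le> (2 * real m) * sqrt q"
      using t(2) False by (intro mult_right_mono) auto
    also have "\<dots> \<le> 25 * real m * sqrt q" by (intro mult_right_mono) auto
    finally show ?thesis unfolding sum by (simp add: m_def)
  qed
qed

section \<open>Octahedral character sums\<close>

text \<open>
  Substitute \<open>x = - c i0 + 1/y\<close>. The factor for \<open>i\<close> becomes \<open>(1 + (c i - c i0) y) / y\<close>. The number of factors
  is even, so the powers of \<open>y\<close> contribute a square, and what is left is a polynomial of odd degree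
  \<open>card I - 1\<close> with constant term \<open>1\<close>. Only the root \<open>- c i0\<close> has to be simple for this.
\<close>
lemma quad_char_shifted_product_sum_bound:
  fixes c :: "'i \<Rightarrow> 'a::finite_field"
  assumes q: "q = CARD('a)" "odd q" "primepow q"
    and I: "finite I" "i0 \<in> I" "even (card I)"
    and c: "\<And>i. i \<in> I \<Longrightarrow> i \<noteq> i0 \<Longrightarrow> c i \<noteq> c i0"
  shows "\<bar>real_of_int (\<Sum>x\<in>UNIV. \<Prod>i\<in>I. quad_char (x + c i))\<bar> \<le> 25 * real (card I) * sqrt q"
proof -
  note odd = q(2)[unfolded q(1)]
  define b where "b = (\<lambda>i. c i - c i0)"
  define f where "f = (\<Prod>i\<in>I - {i0}. [:1, b i:])"
  have deg: "Suc (degree f) = card I"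
  proof -
    have "degree f = (\<Sum>i\<in>I - {i0}. degree [:1, b i:])"
      unfolding f_def by (rule degree_prod_eq_sum_degree) auto
    also have "\<dots> = (\<Sum>i\<in>I - {i0}. 1)"
      using c by (intro sum.cong) (auto simp: b_def)
    moreover have "card I > 0" using I by (auto simp: card_gt_0_iff)
    ultimately show ?thesis using I by simp
  qed
  have f0: "poly f 0 = 1" by (simp add: f_def poly_prod)
  have factor: "(\<Prod>i\<in>I. quad_char (- c i0 + inverse y + c i)) = quad_char (poly f y)"
    if y: "y \<noteq> 0" for y
  proof -
    have "(\<Prod>i\<in>I. - c i0 + inverse y + c i) = (\<Prod>i\<in>I. inverse y * (1 + b i * y))"
      using y by (intro prod.cong) (auto simp: b_def field_simps)
    also have "\<dots> = inverse y ^ card I * (\<Prod>i\<in>I. 1 + b i * y)"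
      by (simp add: prod.distrib)
    also have "(\<Prod>i\<in>I. 1 + b i * y) = (\<Prod>i\<in>I - {i0}. 1 + b i * y)"
      using I by (simp add: prod.remove[of I i0] b_def)
    also have "\<dots> = poly f y" by (simp add: f_def poly_prod mult.commute)
    finally have prod: "(\<Prod>i\<in>I. - c i0 + inverse y + c i) = inverse y ^ card I * poly f y" .
    obtain h where "card I = 2 * h" using I(3) by auto
    then have "inverse y ^ card I = (inverse y ^ h) ^ 2" by (simp add: power_mult[symmetric] mult.commute)
    then have "quad_char (inverse y ^ card I) = 1"
      using y by (auto simp: quad_char_def)
    then show ?thesis
      using arg_cong[OF prod, of quad_char] by (simp add: quad_char_prod[OF odd] quad_char_mult[OF odd])
  qed
  have "(\<Sum>x\<in>UNIV. \<Prod>i\<in>I. quad_char (x + c i)) = (\<Sum>x\<in>UNIV - {- c i0}. \<Prod>i\<in>I. quad_char (x + c i))"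
    using I by (intro sum.mono_neutral_right) (auto intro!: bexI[of _ i0])
  also have "\<dots> = (\<Sum>y\<in>UNIV - {0}. quad_char (poly f y))"
    by (rule sum.reindex_bij_witness[of _ "\<lambda>y. - c i0 + inverse y" "\<lambda>x. inverse (x + c i0)"])
      (auto simp: factor[symmetric] eq_neg_iff_add_eq_0)
  also have "\<dots> = (\<Sum>y\<in>UNIV. quad_char (poly f y)) - 1"
    by (simp add: sum_diff1 f0)
  finally have eq: "real_of_int (\<Sum>x\<in>UNIV. \<Prod>i\<in>I. quad_char (x + c i))
      = real_of_int (\<Sum>y\<in>UNIV. quad_char (poly f y)) - 1" by simp
  \<comment> \<open>The subtracted \<open>1\<close> is the term at \<open>y = 0\<close>; the factor \<open>card I\<close> in place of \<open>degree f\<close> absorbs it.\<close>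
  have "odd (degree f)" using deg I(3) by (metis even_Suc)
  then have "\<bar>real_of_int (\<Sum>y\<in>UNIV. quad_char (poly f y))\<bar> \<le> 25 * real (degree f) * sqrt q"
    using quad_char_sum_bound[OF q] f0 by simp
  moreover have "sqrt q \<ge> 1" using card_ge_3[OF odd] q(1) by simp
  moreover have "25 * real (card I) * sqrt q = 25 * real (degree f) * sqrt q + 25 * sqrt q"
    by (simp add: algebra_simps flip: deg)
  ultimately show ?thesis unfolding eq by linarith
qed

lemma sum_PiE_insert:
  assumes "a \<notin> V"
  shows "(\<Sum>u\<in>PiE (insert a V) F. g u) = (\<Sum>v\<in>PiE V F. \<Sum>x\<in>F a. g (v(a := x)))"
proof -
  have "(\<Sum>u\<in>PiE (insert a V) F. g u) = (\<Sum>(x, v)\<in>F a \<times> PiE V F. g (v(a := x)))"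
    unfolding PiE_insert_eq
    by (subst sum.reindex) (auto simp: inj_combinator[OF assms] case_prod_beta intro: sum.cong)
  then show ?thesis
    by (subst sum.swap) (simp add: sum.cartesian_product)
qed

lemma prod_PiE_insert:
  assumes "a \<notin> V"
  shows "(\<Prod>u\<in>PiE (insert a V) F. g u) = (\<Prod>v\<in>PiE V F. \<Prod>x\<in>F a. g (v(a := x)))"
proof -
  have "(\<Prod>u\<in>PiE (insert a V) F. g u) = (\<Prod>(x, v)\<in>F a \<times> PiE V F. g (v(a := x)))"
    unfolding PiE_insert_eq
    by (subst prod.reindex) (auto simp: inj_combinator[OF assms] case_prod_beta intro: prod.cong)
  then show ?thesis
    by (subst prod.swap) (simp add: prod.cartesian_product)
qed

text \<open>A condition that determines one coordinate from the others costs a factor \<open>q\<close>.\<close>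
lemma card_PiE_determined_coordinate:
  fixes P :: "('v \<Rightarrow> 'a::finite) \<Rightarrow> bool"
  assumes V: "finite V" "a \<in> V"
    and P: "\<And>u x y. P (u(a := x)) \<Longrightarrow> P (u(a := y)) \<Longrightarrow> x = y"
  shows "card {u \<in> V \<rightarrow>\<^sub>E UNIV. P u} \<le> CARD('a) ^ (card V - 1)"
proof -
  let ?S = "{u \<in> V \<rightarrow>\<^sub>E UNIV. P u}"
  have "inj_on (\<lambda>u. restrict u (V - {a})) ?S"
  proof (rule inj_onI)
    fix u v assume u: "u \<in> ?S" and v: "v \<in> ?S"
      and eq: "restrict u (V - {a}) = restrict v (V - {a})"
    have agree: "u w = v w" if "w \<noteq> a" for w
    proof (cases "w \<in> V")
      case True
      then show ?thesis using fun_cong[OF eq, of w] that by simp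
    next
      case False
      then show ?thesis using u v by (auto simp: PiE_def extensional_def)
    qed
    then have v_eq: "v = u(a := v a)" by auto
    have "P (u(a := u a))" "P (u(a := v a))" using u v v_eq by auto
    then have "u a = v a" by (rule P)
    then show "u = v" using v_eq by (metis fun_upd_triv)
  qed
  then have "card ?S = card ((\<lambda>u. restrict u (V - {a})) ` ?S)" by (simp add: card_image)
  also have "\<dots> \<le> card ((V - {a}) \<rightarrow>\<^sub>E (UNIV :: 'a set))"
    using V(1) by (intro card_mono finite_PiE) auto
  also have "\<dots> = CARD('a) ^ (card V - 1)" using V by (simp add: card_funcsetE)
  finally show ?thesis .
qed

text \<open>
  The vertices of the octahedron over \<open>I\<close> are the pairs \<open>(i, b)\<close>; a choice \<open>\<epsilon>\<close> of one vertex for each \<open>i\<close> is an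
  edge.
\<close>
definition face_sum :: "'i set \<Rightarrow> ('i \<times> bool \<Rightarrow> 'a::comm_monoid_add) \<Rightarrow> ('i \<Rightarrow> bool) \<Rightarrow> 'a" where
  "face_sum I u \<epsilon> = (\<Sum>i\<in>I. u (i, \<epsilon> i))"

lemma face_sum_update:
  fixes u :: "'i \<times> bool \<Rightarrow> 'a::comm_monoid_add"
  assumes "finite I" "i \<in> I" 
  shows "\<epsilon> i = b \<Longrightarrow> face_sum I (u((i, b) := x)) \<epsilon> = x + face_sum (I - {i}) u \<epsilon>"
    "\<epsilon> i \<noteq> b \<Longrightarrow> face_sum I (u((i, b) := x)) \<epsilon> = face_sum I u \<epsilon>"
  using assms by (auto simp: face_sum_def sum.remove intro!: sum.cong)

text \<open>
  For fixed labels of the other classes, the product over the edges splits into the edges through \<open>(a, False)\<close>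
  and those through \<open>(a, True)\<close>, and both parts are the same function of the label of that vertex.
\<close>
lemma octahedral_sum_as_squares:
  fixes \<chi> :: "'a::{finite, comm_monoid_add} \<Rightarrow> 'r::comm_ring_1"
  assumes "finite I" "a \<notin> I"
  shows "(\<Sum>u\<in>insert a I \<times> UNIV \<rightarrow>\<^sub>E UNIV. \<Prod>\<epsilon>\<in>insert a I \<rightarrow>\<^sub>E UNIV. \<chi> (face_sum (insert a I) u \<epsilon>))
    = (\<Sum>v\<in>I \<times> UNIV \<rightarrow>\<^sub>E UNIV. (\<Sum>x\<in>UNIV. \<Prod>\<epsilon>\<in>I \<rightarrow>\<^sub>E UNIV. \<chi> (x + face_sum I v \<epsilon>)) ^ 2)"
proof -
  have V: "insert a I \<times> (UNIV::bool set) = insert (a, False) (insert (a, True) (I \<times> UNIV))"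
    by (auto intro: bool.exhaust)
  have face: "face_sum (insert a I) (v((a, True) := y, (a, False) := x)) (\<epsilon>(a := b))
      = (if b then y else x) + face_sum I v \<epsilon>" for v :: "_ \<Rightarrow> 'a" and x y b \<epsilon>
    using assms unfolding face_sum_def by (auto intro!: sum.cong arg_cong2[where f = "(+)"])
  have "(\<Sum>u\<in>insert a I \<times> UNIV \<rightarrow>\<^sub>E UNIV. \<Prod>\<epsilon>\<in>insert a I \<rightarrow>\<^sub>E UNIV. \<chi> (face_sum (insert a I) u \<epsilon>))
    = (\<Sum>v\<in>I \<times> UNIV \<rightarrow>\<^sub>E UNIV. \<Sum>y\<in>UNIV. \<Sum>x\<in>UNIV. \<Prod>\<epsilon>\<in>I \<rightarrow>\<^sub>E UNIV.
        \<chi> (x + face_sum I v \<epsilon>) * \<chi> (y + face_sum I v \<epsilon>))"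
    unfolding V using assms
    by (simp add: sum_PiE_insert prod_PiE_insert face UNIV_bool mult.commute del: fun_upd_apply)
  also have "\<dots> = (\<Sum>v\<in>I \<times> UNIV \<rightarrow>\<^sub>E UNIV. (\<Sum>x\<in>UNIV. \<Prod>\<epsilon>\<in>I \<rightarrow>\<^sub>E UNIV. \<chi> (x + face_sum I v \<epsilon>)) ^ 2)"
    by (simp add: power2_eq_square sum_product prod.distrib)
      (auto intro!: sum.cong sum.swap)
  finally show ?thesis .
qed

text \<open>
  A labeling \<open>v\<close> of the \<open>n\<close> remaining classes is bad if the edge sum for the all-False choice \<open>e0\<close> is attained
  by another choice. The good labelings contribute \<open>O(q)\<close> each, the at most \<open>2^n q^(2n-1)\<close> bad ones at
  most \<open>q\<^sup>2\<close> each.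
\<close>
lemma octahedral_quad_char_sum_bound:
  fixes I :: "'i set"
  assumes q: "q = CARD('a::finite_field)" "odd q" "primepow q"
    and I: "finite I" "card I \<ge> 2"
  defines "n \<equiv> card I - 1"
  shows "\<bar>real_of_int (\<Sum>u\<in>I \<times> UNIV \<rightarrow>\<^sub>E UNIV. \<Prod>\<epsilon>\<in>I \<rightarrow>\<^sub>E UNIV. quad_char (face_sum I u \<epsilon> :: 'a))\<bar>
    \<le> (625 * 4 ^ n + 2 ^ n) * real q ^ (2 * n + 1)"
proof -
  obtain a where "a \<in> I" using I by fastforce
  define J where "J = I - {a}"
  have IJ: "I = insert a J" "a \<notin> J" "finite J" "card J = n" "n \<ge> 1"
    using \<open>a \<in> I\<close> I by (auto simp: J_def n_def)
  define E where "E = J \<rightarrow>\<^sub>E (UNIV::bool set)"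
  define U where "U = J \<times> (UNIV::bool set) \<rightarrow>\<^sub>E (UNIV::'a set)"
  define e0 where "e0 = restrict (\<lambda>_. False) J"
  have E: "finite E" "card E = 2 ^ n" "e0 \<in> E"
    using IJ by (simp_all add: E_def finite_PiE card_funcsetE e0_def)
  have U: "finite U" "card U = q ^ (2 * n)"
    using IJ by (simp_all add: U_def finite_PiE card_funcsetE card_cartesian_product q(1) mult.commute)
  define T where "T = (\<lambda>v. real_of_int (\<Sum>x\<in>UNIV. \<Prod>\<epsilon>\<in>E. quad_char (x + face_sum J v \<epsilon> :: 'a)))"
  define Bad where "Bad = {v \<in> U. \<exists>\<epsilon>\<in>E - {e0}. face_sum J v \<epsilon> = face_sum J v e0}"
  have bad_card: "real (card Bad) \<le> 2 ^ n * real q ^ (2 * n - 1)"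
  proof -
    have "Bad = (\<Union>\<epsilon>\<in>E - {e0}. {v \<in> U. face_sum J v \<epsilon> = face_sum J v e0})"
      by (auto simp: Bad_def)
    then have "card Bad \<le> (\<Sum>\<epsilon>\<in>E - {e0}. card {v \<in> U. face_sum J v \<epsilon> = face_sum J v e0})"
      using E by (simp add: card_UN_le)
    also have "\<dots> \<le> (\<Sum>\<epsilon>\<in>E - {e0}. q ^ (2 * n - 1))"
    proof (rule sum_mono)
      fix \<epsilon> assume \<epsilon>: "\<epsilon> \<in> E - {e0}"
      \<comment> \<open>At such an \<open>i\<close>, the label of \<open>(i, True)\<close> enters the sum for \<open>\<epsilon>\<close> but not the one for \<open>e0\<close>.\<close>
      obtain i where i: "i \<in> J" "\<epsilon> i"
      proof -
        have "\<exists>i\<in>J. \<epsilon> i \<noteq> e0 i" using \<epsilon> E(3) PiE_ext[of \<epsilon> J _ e0] unfolding E_def by blast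
        then show ?thesis using that by (auto simp: e0_def)
      qed
      have "card {v \<in> J \<times> (UNIV::bool set) \<rightarrow>\<^sub>E (UNIV::'a set). face_sum J v \<epsilon> = face_sum J v e0}
          \<le> CARD('a) ^ (card (J \<times> (UNIV::bool set)) - 1)"
      proof (rule card_PiE_determined_coordinate)
        show "(i, True) \<in> J \<times> UNIV" using i by simp
        fix u :: "'i \<times> bool \<Rightarrow> 'a" and x y
        assume "face_sum J (u((i, True) := x)) \<epsilon> = face_sum J (u((i, True) := x)) e0"
          "face_sum J (u((i, True) := y)) \<epsilon> = face_sum J (u((i, True) := y)) e0"
        moreover have "\<epsilon> i = True" "e0 i \<noteq> True" using i by (auto simp: e0_def)
        ultimately have "x + face_sum (J - {i}) u \<epsilon> = y + face_sum (J - {i}) u \<epsilon>"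
          using IJ(3) i by (simp add: face_sum_update)
        then show "x = y" by simp
      qed (use IJ in simp)
      then show "card {v \<in> U. face_sum J v \<epsilon> = face_sum J v e0} \<le> q ^ (2 * n - 1)"
        using IJ by (simp add: U_def card_cartesian_product q(1) mult.commute)
    qed
    also have "\<dots> \<le> 2 ^ n * q ^ (2 * n - 1)"
      using E by simp
    finally have "real (card Bad) \<le> real (2 ^ n * q ^ (2 * n - 1))" by (rule of_nat_mono)
    then show ?thesis by simp
  qed
  have trivial: "T v ^ 2 \<le> real q ^ 2" for v
  proof -
    have "\<bar>\<Sum>x\<in>UNIV. \<Prod>\<epsilon>\<in>E. quad_char (x + face_sum J v \<epsilon> :: 'a)\<bar>
        \<le> (\<Sum>x\<in>(UNIV::'a set). 1)"
      by (intro order_trans[OF sum_abs] sum_mono) (simp add: abs_prod prod_le_1 abs_quad_char_le_1)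
    also have "\<dots> = int q" by (simp add: q(1))
    finally have "real_of_int \<bar>\<Sum>x\<in>UNIV. \<Prod>\<epsilon>\<in>E. quad_char (x + face_sum J v \<epsilon> :: 'a)\<bar>
        \<le> real_of_int (int q)"
      by (simp only: of_int_le_iff)
    then have "\<bar>T v\<bar> \<le> real q" unfolding T_def by (simp only: of_int_abs of_int_of_nat_eq)
    then show ?thesis by (metis abs_ge_zero power2_abs power_mono)
  qed
  have good: "T v ^ 2 \<le> 625 * 4 ^ n * real q" if v: "v \<in> U - Bad" for v
  proof -
    have "\<bar>T v\<bar> \<le> 25 * real (card E) * sqrt q"
      unfolding T_def
    proof (rule quad_char_shifted_product_sum_bound[OF q E(1,3)])
      show "even (card E)" using E(2) IJ(5) by simp
      show "face_sum J v \<epsilon> \<noteq> face_sum J v e0" if "\<epsilon> \<in> E" "\<epsilon> \<noteq> e0" for \<epsilon>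
        using v that by (auto simp: Bad_def)
    qed
    then have "\<bar>T v\<bar> ^ 2 \<le> (25 * real (card E) * sqrt q) ^ 2" by (intro power_mono) auto
    also have "\<dots> = 625 * (2 ^ n) ^ 2 * real q" by (simp add: E(2) power_mult_distrib)
    also have "(2 ^ n) ^ 2 = (4 ^ n :: real)" by (simp add: power2_eq_square flip: power_mult_distrib)
    finally show ?thesis by simp
  qed
  have "real_of_int (\<Sum>u\<in>I \<times> UNIV \<rightarrow>\<^sub>E UNIV. \<Prod>\<epsilon>\<in>I \<rightarrow>\<^sub>E UNIV. quad_char (face_sum I u \<epsilon> :: 'a))
      = (\<Sum>v\<in>U. T v ^ 2)"
    using IJ octahedral_sum_as_squares[of J a "quad_char :: 'a \<Rightarrow> int"] by (simp add: U_def T_def E_def)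
  moreover have "\<bar>\<Sum>v\<in>U. T v ^ 2\<bar> = (\<Sum>v\<in>U. T v ^ 2)"
    by (intro abs_of_nonneg sum_nonneg) simp
  moreover have "(\<Sum>v\<in>U. T v ^ 2) = (\<Sum>v\<in>Bad. T v ^ 2) + (\<Sum>v\<in>U - Bad. T v ^ 2)"
    using U(1) by (intro sum.subset_diff[THEN trans[OF _ add.commute]]) (auto simp: Bad_def)
  moreover have "(\<Sum>v\<in>Bad. T v ^ 2) \<le> real (card Bad) * real q ^ 2"
    using sum_bounded_above[of Bad "\<lambda>v. T v ^ 2" "real q ^ 2"] trivial by simp
  moreover have "real (card Bad) * real q ^ 2 \<le> 2 ^ n * real q ^ (2 * n + 1)"
  proof -
    have "2 * n + 1 = (2 * n - 1) + 2" using IJ(5) by simp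
    then have "2 ^ n * real q ^ (2 * n + 1) = 2 ^ n * real q ^ (2 * n - 1) * real q ^ 2"
      by (metis mult.assoc power_add)
    moreover have "real (card Bad) * real q ^ 2 \<le> 2 ^ n * real q ^ (2 * n - 1) * real q ^ 2"
      using bad_card by (rule mult_right_mono) simp
    ultimately show ?thesis by simp
  qed
  moreover have "(\<Sum>v\<in>U - Bad. T v ^ 2) \<le> real (card (U - Bad)) * (625 * 4 ^ n * real q)"
    using sum_bounded_above[of "U - Bad" "\<lambda>v. T v ^ 2" "625 * 4 ^ n * real q"] good by simp
  moreover have "real (card (U - Bad)) * (625 * 4 ^ n * real q) \<le> real (q ^ (2 * n)) * (625 * 4 ^ n * real q)"
    using card_mono[OF U(1), of "U - Bad"] U(2) by (intro mult_right_mono) auto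
  ultimately show ?thesis by (simp add: algebra_simps)
qed

section \<open>Labelings with an even number of square edge sums\<close>
lemma card_exceptional_labelings:
  fixes I :: "'i set"
  assumes I: "finite I" "I \<noteq> {}"
  defines "V \<equiv> I \<times> (UNIV::bool set)"
  shows "card {u \<in> V \<rightarrow>\<^sub>E (UNIV::'a::finite_field set).
      \<not> inj_on u V \<or> (\<exists>\<epsilon>\<in>I \<rightarrow>\<^sub>E UNIV. face_sum I u \<epsilon> = 0)}
    \<le> (4 * card I ^ 2 + 2 ^ card I) * CARD('a) ^ (2 * card I - 1)"
proof -
  define U where "U = (V \<rightarrow>\<^sub>E (UNIV::'a set))"
  define E where "E = I \<rightarrow>\<^sub>E (UNIV::bool set)"
  define Q where "Q = CARD('a) ^ (2 * card I - 1)"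
  define D where "D = {(w, w') \<in> V \<times> V. w \<noteq> w'}"
  have V: "finite V" "card V = 2 * card I" using I by (simp_all add: V_def card_cartesian_product)
  have E: "finite E" "card E = 2 ^ card I" using I by (simp_all add: E_def finite_PiE card_funcsetE)
  have D: "finite D" "card D \<le> 4 * card I ^ 2"
  proof -
    have "D \<subseteq> V \<times> V" by (auto simp: D_def)
    then show "finite D" "card D \<le> 4 * card I ^ 2"
      using V card_mono[of "V \<times> V" D] finite_subset[of D "V \<times> V"]
      by (simp_all add: card_cartesian_product power2_eq_square)
  qed
  have coincide: "card {u \<in> U. u (fst d) = u (snd d)} \<le> Q" if "d \<in> D" for d
  proof -
    have d: "fst d \<in> V" "fst d \<noteq> snd d" using that by (auto simp: D_def)
    have "card {u \<in> V \<rightarrow>\<^sub>E (UNIV::'a set). u (fst d) = u (snd d)} \<le> CARD('a) ^ (card V - 1)"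
      by (rule card_PiE_determined_coordinate[OF V(1) d(1)]) (use d(2) in auto)
    then show ?thesis by (simp add: U_def Q_def V)
  qed
  have vanish: "card {u \<in> U. face_sum I u \<epsilon> = 0} \<le> Q" if "\<epsilon> \<in> E" for \<epsilon>
  proof -
    obtain i where i: "i \<in> I" using I by blast
    have "card {u \<in> V \<rightarrow>\<^sub>E (UNIV::'a set). face_sum I u \<epsilon> = 0} \<le> CARD('a) ^ (card V - 1)"
    proof (rule card_PiE_determined_coordinate[OF V(1)])
      show "(i, \<epsilon> i) \<in> V" using i by (simp add: V_def)
      fix u :: "'i \<times> bool \<Rightarrow> 'a" and x y
      assume "face_sum I (u((i, \<epsilon> i) := x)) \<epsilon> = 0" "face_sum I (u((i, \<epsilon> i) := y)) \<epsilon> = 0"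
      then have "x + face_sum (I - {i}) u \<epsilon> = y + face_sum (I - {i}) u \<epsilon>"
        using I(1) i by (simp add: face_sum_update)
      then show "x = y" by simp
    qed
    then show ?thesis by (simp add: U_def Q_def V)
  qed
  let ?X = "(\<Union>d\<in>D. {u \<in> U. u (fst d) = u (snd d)})" and ?Y = "(\<Union>\<epsilon>\<in>E. {u \<in> U. face_sum I u \<epsilon> = 0})"
  have fin: "finite U" using V by (simp add: U_def finite_PiE)
  have "{u \<in> U. \<not> inj_on u V \<or> (\<exists>\<epsilon>\<in>E. face_sum I u \<epsilon> = 0)} \<subseteq> ?X \<union> ?Y"
    by (fastforce simp: inj_on_def D_def)
  then have "card {u \<in> U. \<not> inj_on u V \<or> (\<exists>\<epsilon>\<in>E. face_sum I u \<epsilon> = 0)} \<le> card (?X \<union> ?Y)"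
    using fin D(1) E(1) by (intro card_mono) auto
  also have "\<dots> \<le> card ?X + card ?Y" by (rule card_Un_le)
  also have "card ?X \<le> (\<Sum>d\<in>D. Q)"
    using D(1) coincide by (intro order_trans[OF card_UN_le] sum_mono) auto
  also have "card ?Y \<le> (\<Sum>\<epsilon>\<in>E. Q)"
    using E(1) vanish by (intro order_trans[OF card_UN_le] sum_mono) auto
  also have "(\<Sum>d\<in>D. Q) + (\<Sum>\<epsilon>\<in>E. Q) = (card D + 2 ^ card I) * Q"
    by (simp add: E algebra_simps)
  also have "\<dots> \<le> (4 * card I ^ 2 + 2 ^ card I) * Q"
    using D(2) by (intro mult_right_mono) auto
  finally show ?thesis by (simp add: U_def E_def Q_def)
qed

text \<open>
  The first two terms come from the exceptional labelings, the last one is half the constant of the octahedral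
  character sum.
\<close>
definition epo_constant :: "nat \<Rightarrow> real" where
  "epo_constant k = 4 * real k ^ 2 + 2 ^ k + (625 * 4 ^ (k - 1) + 2 ^ (k - 1)) / 2"

text \<open>
  Outside the exceptional set, \<open>2 \<cdot> [u is counted] = 1 + \<Prod>\<^sub>\<epsilon> \<chi>(s(u,\<epsilon>))\<close>; on it the two sides differ by at
  most \<open>2\<close>. Summing over all \<open>q^(2k)\<close> labelings gives the estimate.
\<close>
lemma even_square_faces_count:
  fixes I :: "'i set"
  assumes q: "q = CARD('a::finite_field)" "odd q" "primepow q"
    and I: "finite I" "card I \<ge> 2"
  defines "V \<equiv> I \<times> (UNIV::bool set)"
  shows "\<bar>real (card {u \<in> V \<rightarrow>\<^sub>E (UNIV::'a set). inj_on u V \<and>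
            even (card {\<epsilon> \<in> I \<rightarrow>\<^sub>E UNIV. \<exists>y. face_sum I u \<epsilon> = y ^ 2})})
          - real q ^ (2 * card I) / 2\<bar>
         \<le> epo_constant (card I) * real q ^ (2 * card I - 1)"
proof -
  define U where "U = (V \<rightarrow>\<^sub>E (UNIV::'a set))"
  define E where "E = I \<rightarrow>\<^sub>E (UNIV::bool set)"
  define Sq where "Sq = (\<lambda>u::'i \<times> bool \<Rightarrow> 'a. {\<epsilon> \<in> E. \<exists>y. face_sum I u \<epsilon> = y ^ 2})"
  define good where "good = {u \<in> U. inj_on u V \<and> even (card (Sq u))}"
  define w where "w = (\<lambda>u::'i \<times> bool \<Rightarrow> 'a. \<Prod>\<epsilon>\<in>E. quad_char (face_sum I u \<epsilon>))"
  define Exc where "Exc = {u \<in> U. \<not> inj_on u V \<or> (\<exists>\<epsilon>\<in>E. face_sum I u \<epsilon> = 0)}"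
  have Ine: "I \<noteq> {}" using I(2) by auto
  have E: "finite E" "card E = 2 ^ card I" using I by (simp_all add: E_def finite_PiE card_funcsetE)
  have evenE: "even (card E)" using I(2) by (simp add: E)
  have U: "finite U" "card U = q ^ (2 * card I)"
    using I by (simp_all add: U_def V_def finite_PiE card_funcsetE card_cartesian_product q(1) mult.commute)
  have w_eq: "w u = (-1) ^ card (Sq u)" if "\<forall>\<epsilon>\<in>E. face_sum I u \<epsilon> \<noteq> 0" for u
  proof -
    have "w u = (\<Prod>\<epsilon>\<in>E. - (if \<epsilon> \<in> Sq u then -1 else 1))"
      unfolding w_def using that by (intro prod.cong) (auto simp: quad_char_def Sq_def)
    also have "\<dots> = (-1) ^ card E * (\<Prod>\<epsilon>\<in>E. if \<epsilon> \<in> Sq u then -1 else 1)"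
      by (subst minus_one_mult_self[symmetric, of 0]) (simp add: prod_uminus)
    also have "(\<Prod>\<epsilon>\<in>E. if \<epsilon> \<in> Sq u then -1 else (1::int)) = (\<Prod>\<epsilon>\<in>Sq u. -1)"
      using E(1) by (simp add: prod.If_cases Sq_def Int_def conj_commute)
    finally show ?thesis using evenE by simp
  qed
  have w_abs: "\<bar>w u\<bar> \<le> 1" for u
    by (simp add: w_def abs_prod prod_le_1 abs_quad_char_le_1)
  have local: "\<bar>2 * of_bool (u \<in> good) - 1 - w u\<bar> \<le> 2 * of_bool (u \<in> Exc)" if "u \<in> U" for u
  proof (cases "u \<in> Exc")
    case True
    then show ?thesis using w_abs[of u] by (auto simp: abs_le_iff)
  next
    case False
    then have "inj_on u V" "w u = (-1) ^ card (Sq u)" using that w_eq by (auto simp: Exc_def)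
    then show ?thesis using that by (auto simp: good_def)
  qed
  have "int (card good) = (\<Sum>u\<in>U. of_bool (u \<in> good))"
    using U(1) by (simp add: good_def Int_def)
  then have "2 * int (card good) - int (card U) - (\<Sum>u\<in>U. w u)
      = (\<Sum>u\<in>U. 2 * of_bool (u \<in> good) - 1 - w u)"
    by (simp add: sum_subtractf sum_distrib_left)
  also have "\<bar>\<dots>\<bar> \<le> (\<Sum>u\<in>U. 2 * of_bool (u \<in> Exc))"
    by (intro order_trans[OF sum_abs] sum_mono local)
  also have "\<dots> = 2 * int (card Exc)"
    using U(1) by (simp add: sum_distrib_left[symmetric] Exc_def Int_def)
  finally have "\<bar>2 * int (card good) - int (card U) - (\<Sum>u\<in>U. w u)\<bar> \<le> 2 * int (card Exc)" .
  then have "real_of_int \<bar>2 * int (card good) - int (card U) - (\<Sum>u\<in>U. w u)\<bar> \<le> real_of_int (2 * int (card Exc))"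
    by (simp only: of_int_le_iff)
  then have main: "\<bar>2 * real (card good) - real q ^ (2 * card I) - real_of_int (\<Sum>u\<in>U. w u)\<bar> \<le> 2 * real (card Exc)"
    by (simp add: U(2))
  have "card Exc \<le> (4 * card I ^ 2 + 2 ^ card I) * q ^ (2 * card I - 1)"
    using card_exceptional_labelings[OF I(1) Ine, where 'a = 'a]
    by (simp add: Exc_def U_def E_def V_def q(1))
  then have "real (card Exc) \<le> real ((4 * card I ^ 2 + 2 ^ card I) * q ^ (2 * card I - 1))"
    by (rule of_nat_mono)
  then have exc: "real (card Exc) \<le> (4 * real (card I) ^ 2 + 2 ^ card I) * real q ^ (2 * card I - 1)"
    by simp
  have "2 * (card I - 1) + 1 = 2 * card I - 1" using I(2) by simp
  then have sum: "\<bar>real_of_int (\<Sum>u\<in>U. w u)\<bar>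
      \<le> (625 * 4 ^ (card I - 1) + 2 ^ (card I - 1)) * real q ^ (2 * card I - 1)"
    using octahedral_quad_char_sum_bound[OF q I] by (simp add: U_def V_def w_def E_def)
  have "\<bar>2 * real (card good) - real q ^ (2 * card I)\<bar>
      \<le> 2 * ((4 * real (card I) ^ 2 + 2 ^ card I) * real q ^ (2 * card I - 1))
        + (625 * 4 ^ (card I - 1) + 2 ^ (card I - 1)) * real q ^ (2 * card I - 1)"
    using main exc sum by linarith
  also have "\<dots> = 2 * (epo_constant (card I) * real q ^ (2 * card I - 1))"
    by (simp add: epo_constant_def field_simps)
  finally have "\<bar>real (card good) - real q ^ (2 * card I) / 2\<bar>
      \<le> epo_constant (card I) * real q ^ (2 * card I - 1)"
    by linarith
  then show ?thesis by (simp add: good_def U_def Sq_def E_def)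
qed

section \<open>Copies of even partial octahedra as labelings\<close>

text \<open>
  An injection \<open>f\<close> determines the hypergraph of which it is an induced copy: its edges are the \<open>k\<close>-sets that
  \<open>f\<close> maps to edges. So the sum over all EPOs counts each injection once or not at all, according
  to the parity of the number of octahedral edges that it maps to edges.
\<close>
lemma epo_count_eq_card_injections:
  fixes G :: "'v hypergraph" and k :: nat
  assumes "finite (verts G)"
  defines "V \<equiv> {1..k} \<times> (UNIV::bool set)"
  shows "epo_count k G = card {f \<in> V \<rightarrow>\<^sub>E verts G. inj_on f V \<and>
    even (card {\<epsilon> \<in> {1..k} \<rightarrow>\<^sub>E UNIV. f ` (\<lambda>i. (i, \<epsilon> i)) ` {1..k} \<in> edges G})}"
proof -
  define facet where "facet = (\<lambda>\<epsilon>::nat \<Rightarrow> bool. (\<lambda>i. (i, \<epsilon> i)) ` {1..k})"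
  define E where "E = {1..k} \<rightarrow>\<^sub>E (UNIV::bool set)"
  define copies where "copies = (\<lambda>H::(nat \<times> bool) hypergraph. {f \<in> verts H \<rightarrow>\<^sub>E verts G. inj_on f (verts H) \<and>
             (\<forall>S. S \<subseteq> verts H \<and> card S = k \<longrightarrow> (S \<in> edges H \<longleftrightarrow> f ` S \<in> edges G))})"
  have V: "verts (octahedron k) = V" by (simp add: octahedron_def V_def)
  have facet_verts: "facet \<epsilon> \<subseteq> V" "card (facet \<epsilon>) = k" for \<epsilon>
    by (auto simp: facet_def V_def card_image inj_on_def)
  have facet_inj: "inj_on facet E"
  proof (rule inj_onI)
    fix \<epsilon> \<epsilon>' assume *: "\<epsilon> \<in> E" "\<epsilon>' \<in> E" "facet \<epsilon> = facet \<epsilon>'"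
    have "\<epsilon> i = \<epsilon>' i" if "i \<in> {1..k}" for i
    proof -
      have "(i, \<epsilon> i) \<in> facet \<epsilon>'" using that unfolding *(3)[symmetric] by (simp add: facet_def)
      then show ?thesis by (auto simp: facet_def)
    qed
    then show "\<epsilon> = \<epsilon>'" using *(1,2) PiE_ext unfolding E_def by blast
  qed
  have oct_edges: "edges (octahedron k) = facet ` E"
  proof -
    have "facet \<epsilon> = facet (restrict \<epsilon> {1..k})" for \<epsilon> by (auto simp: facet_def)
    moreover have "restrict \<epsilon> {1..k} \<in> E" for \<epsilon> by (simp add: E_def)
    ultimately have "facet \<epsilon> \<in> facet ` E" for \<epsilon> by (rule image_eqI)
    then have "range facet = facet ` E" by blast
    moreover have "edges (octahedron k) = range facet"
      by (auto simp: octahedron_def facet_def)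
    ultimately show ?thesis by simp
  qed
  have pattern: "edges H \<inter> edges (octahedron k) = facet ` {\<epsilon> \<in> E. f ` facet \<epsilon> \<in> edges G}"
    if "f \<in> copies H" "verts H = V" for f H
    using that facet_verts by (auto simp: oct_edges copies_def)
  have card_pattern: "card (facet ` {\<epsilon> \<in> E. f ` facet \<epsilon> \<in> edges G}) = card {\<epsilon> \<in> E. f ` facet \<epsilon> \<in> edges G}" for f
    by (rule card_image) (rule inj_on_subset[OF facet_inj], auto)
  have union: "(\<Union>H\<in>even_partial_octahedra k. copies H) =
    {f \<in> V \<rightarrow>\<^sub>E verts G. inj_on f V \<and> even (card {\<epsilon> \<in> E. f ` facet \<epsilon> \<in> edges G})}"
  proof (intro equalityI subsetI)
    fix f assume "f \<in> (\<Union>H\<in>even_partial_octahedra k. copies H)"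
    then obtain H where H: "H \<in> even_partial_octahedra k" "f \<in> copies H" by blast
    then have HV: "verts H = V" by (simp add: even_partial_octahedra_def V)
    have "even (card {\<epsilon> \<in> E. f ` facet \<epsilon> \<in> edges G})"
      using H(1) pattern[OF H(2) HV] card_pattern[of f] by (simp add: even_partial_octahedra_def)
    then show "f \<in> {f \<in> V \<rightarrow>\<^sub>E verts G. inj_on f V \<and> even (card {\<epsilon> \<in> E. f ` facet \<epsilon> \<in> edges G})}"
      using H(2) HV by (simp add: copies_def)
  next
    fix f assume "f \<in> {f \<in> V \<rightarrow>\<^sub>E verts G. inj_on f V \<and> even (card {\<epsilon> \<in> E. f ` facet \<epsilon> \<in> edges G})}"
    then have f: "f \<in> V \<rightarrow>\<^sub>E verts G" "inj_on f V" "even (card {\<epsilon> \<in> E. f ` facet \<epsilon> \<in> edges G})"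
      by auto
    \<comment> \<open>The pullback of \<open>G\<close> along \<open>f\<close>.\<close>
    define H where "H = \<lparr>verts = V, edges = {S. S \<subseteq> V \<and> card S = k \<and> f ` S \<in> edges G}\<rparr>"
    have fH: "f \<in> copies H" using f(1,2) by (simp add: copies_def H_def)
    have "finite V" by (simp add: V_def)
    then have "H \<in> even_partial_octahedra k"
      using f(3) pattern[OF fH] card_pattern[of f]
      by (simp add: even_partial_octahedra_def uniform_hypergraph_def V) (simp add: H_def)
    with fH show "f \<in> (\<Union>H\<in>even_partial_octahedra k. copies H)" by blast
  qed
  have "epo_count k G = (\<Sum>H\<in>even_partial_octahedra k. card (copies H))"
    by (simp add: epo_count_def induced_copies_def copies_def)
  also have "\<dots> = card (\<Union>H\<in>even_partial_octahedra k. copies H)"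
  proof (rule card_UN_disjoint[symmetric])
    show "finite (even_partial_octahedra k)" by (rule finite_even_partial_octahedra)
    show "\<forall>H\<in>even_partial_octahedra k. finite (copies H)"
    proof
      fix H assume "H \<in> even_partial_octahedra k"
      then have "finite (verts H)" by (simp add: even_partial_octahedra_def V V_def)
      then have "finite (verts H \<rightarrow>\<^sub>E verts G)" using assms by (intro finite_PiE) auto
      then show "finite (copies H)" by (rule rev_finite_subset) (auto simp: copies_def)
    qed
    show "\<forall>H\<in>even_partial_octahedra k. \<forall>H'\<in>even_partial_octahedra k. H \<noteq> H' \<longrightarrow> copies H \<inter> copies H' = {}"
    proof (intro ballI impI, rule ccontr)
      fix H H' assume H: "H \<in> even_partial_octahedra k" "H' \<in> even_partial_octahedra k" "H \<noteq> H'"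
        and "copies H \<inter> copies H' \<noteq> {}"
      then obtain f where f: "f \<in> copies H" "f \<in> copies H'" by blast
      have HV: "verts H = V" "verts H' = V" using H by (simp_all add: even_partial_octahedra_def V)
      have uni: "S \<subseteq> V \<and> card S = k" if "S \<in> edges H \<or> S \<in> edges H'" for S
        using H(1,2) that HV by (auto simp: even_partial_octahedra_def uniform_hypergraph_def)
      have "S \<in> edges H \<longleftrightarrow> S \<in> edges H'" for S
      proof (cases "S \<subseteq> V \<and> card S = k")
        case True
        then have "S \<in> edges H \<longleftrightarrow> f ` S \<in> edges G" "S \<in> edges H' \<longleftrightarrow> f ` S \<in> edges G"
          using f HV by (simp_all add: copies_def)
        then show ?thesis by simp
      next
        case False
        then show ?thesis using uni by blast
      qed
      then have "edges H = edges H'" by blast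
      then have "H = H'" using HV by (intro hypergraph.equality) simp_all
      then show False using H(3) by simp
    qed
  qed
  finally show ?thesis by (simp add: union facet_def E_def)
qed

text \<open>
  Here \<open>h\<close> identifies the record \<open>R\<close> with a field given by a type class. Injectivity of \<open>u\<close> makes the finite sum
  over the image set of an edge equal to the sum over the \<open>k\<close> positions.
\<close>
lemma epo_count_paley_hypergraph:
  fixes R :: "'a ring" and h :: "'b::finite_field \<Rightarrow> 'a" and k :: nat
  assumes R: "field R"
    and h: "bij_betw h UNIV (carrier R)"
    and h_add: "\<And>x y. h (x + y) = h x \<oplus>\<^bsub>R\<^esub> h y"
    and h_mult: "\<And>x y. h (x * y) = h x \<otimes>\<^bsub>R\<^esub> h y"
  defines "V \<equiv> {1..k} \<times> (UNIV::bool set)"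
  shows "epo_count k (paley_hypergraph k R) = card {u \<in> V \<rightarrow>\<^sub>E (UNIV::'b set). inj_on u V \<and>
    even (card {\<epsilon> \<in> {1..k} \<rightarrow>\<^sub>E UNIV. \<exists>y. face_sum {1..k} u \<epsilon> = y ^ 2})}"
proof -
  interpret R: field R by (rule R)
  have hc: "h x \<in> carrier R" for x using h by (auto simp: bij_betw_def)
  have h_inj: "h x = h y \<longleftrightarrow> x = y" for x y using h by (auto simp: bij_betw_def inj_on_def)
  have h_surj: "\<exists>y. x = h y" if "x \<in> carrier R" for x using h that by (auto simp: bij_betw_def)
  have "h 0 \<oplus>\<^bsub>R\<^esub> h 0 = h 0 \<oplus>\<^bsub>R\<^esub> \<zero>\<^bsub>R\<^esub>"
    using h_add[of 0 0] hc[of 0] by simp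
  then have h_0: "h 0 = \<zero>\<^bsub>R\<^esub>"
    by (rule R.add.l_cancel[OF _ hc R.zero_closed hc])
  have h_sum: "(\<Oplus>\<^bsub>R\<^esub>i\<in>A. h (x i)) = h (\<Sum>i\<in>A. x i)" if "finite A" for A :: "nat set" and x
    using that by induction (simp_all add: h_0 h_add hc Pi_def)
  have h_square: "(\<exists>z\<in>carrier R. h s = z [^]\<^bsub>R\<^esub> (2::nat)) \<longleftrightarrow> (\<exists>y. s = y ^ 2)" for s
  proof -
    have "h y [^]\<^bsub>R\<^esub> (2::nat) = h (y ^ 2)" for y
      by (simp add: numeral_2_eq_2 hc h_mult power2_eq_square)
    then show ?thesis using h_surj hc h_inj by metis
  qed
  define lift where "lift = (\<lambda>u::nat \<times> bool \<Rightarrow> 'b. restrict (h \<circ> u) V)"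
  have edge: "lift u ` (\<lambda>i. (i, \<epsilon> i)) ` {1..k} \<in> edges (paley_hypergraph k R)
      \<longleftrightarrow> (\<exists>y. face_sum {1..k} u \<epsilon> = y ^ 2)"
    if u: "inj_on u V" for u \<epsilon>
  proof -
    define pt where "pt = (\<lambda>i. h (u (i, \<epsilon> i)))"
    have img: "lift u ` (\<lambda>i. (i, \<epsilon> i)) ` {1..k} = pt ` {1..k}"
      unfolding image_image by (rule image_cong) (auto simp: lift_def pt_def V_def)
    have pt: "inj_on pt {1..k}"
    proof (rule inj_onI)
      fix i j assume "i \<in> {1..k}" "j \<in> {1..k}" "pt i = pt j"
      then have "(i, \<epsilon> i) = (j, \<epsilon> j)"
        using u by (auto simp: pt_def h_inj V_def dest: inj_onD)
      then show "i = j" by simp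
    qed
    have "(\<Oplus>\<^bsub>R\<^esub>v\<in>pt ` {1..k}. v) = (\<Oplus>\<^bsub>R\<^esub>i\<in>{1..k}. pt i)"
      by (rule R.finsum_reindex[OF _ pt]) (auto simp: pt_def hc)
    also have "\<dots> = h (face_sum {1..k} u \<epsilon>)"
      unfolding pt_def face_sum_def by (rule h_sum) simp
    finally have "(\<Oplus>\<^bsub>R\<^esub>v\<in>pt ` {1..k}. v) = h (face_sum {1..k} u \<epsilon>)" .
    moreover have "pt ` {1..k} \<subseteq> carrier R" by (auto simp: pt_def hc)
    moreover have "card (pt ` {1..k}) = k" using card_image[OF pt] by simp
    ultimately show ?thesis unfolding img by (simp add: paley_hypergraph_def h_square)
  qed
  have lift_inj_on: "inj_on (lift u) V \<longleftrightarrow> inj_on u V" for u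
    by (simp add: lift_def inj_on_def h_inj)
  have inj_lift: "inj_on lift (V \<rightarrow>\<^sub>E UNIV)"
  proof (rule inj_onI)
    fix u v assume *: "u \<in> V \<rightarrow>\<^sub>E UNIV" "v \<in> V \<rightarrow>\<^sub>E UNIV" "lift u = lift v"
    have "u w = v w" if "w \<in> V" for w
      using fun_cong[OF *(3), of w] that by (simp add: lift_def h_inj)
    then show "u = v" using *(1,2) PiE_ext by blast
  qed
  have lift_range: "lift ` (V \<rightarrow>\<^sub>E UNIV) = V \<rightarrow>\<^sub>E carrier R"
  proof (intro equalityI subsetI)
    fix f assume f: "f \<in> V \<rightarrow>\<^sub>E carrier R"
    define u where "u = restrict (\<lambda>w. SOME y. f w = h y) V"
    have "f w = h (u w)" if "w \<in> V" for w
      using someI_ex[OF h_surj[of "f w"]] f that by (auto simp: u_def)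
    then have "lift u = f"
      using f by (intro ext) (auto simp: lift_def PiE_def extensional_def restrict_def)
    moreover have "u \<in> V \<rightarrow>\<^sub>E UNIV" by (simp add: u_def)
    ultimately show "f \<in> lift ` (V \<rightarrow>\<^sub>E UNIV)" by blast
  qed (auto simp: lift_def hc)
  have "finite (carrier R)" using bij_betw_finite[OF h] by simp
  then have "epo_count k (paley_hypergraph k R) = card {f \<in> V \<rightarrow>\<^sub>E carrier R. inj_on f V \<and>
    even (card {\<epsilon> \<in> {1..k} \<rightarrow>\<^sub>E UNIV. f ` (\<lambda>i. (i, \<epsilon> i)) ` {1..k} \<in> edges (paley_hypergraph k R)})}"
    by (subst epo_count_eq_card_injections) (simp_all add: V_def paley_hypergraph_def)
  also have "{f \<in> V \<rightarrow>\<^sub>E carrier R. inj_on f V \<and>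
    even (card {\<epsilon> \<in> {1..k} \<rightarrow>\<^sub>E UNIV. f ` (\<lambda>i. (i, \<epsilon> i)) ` {1..k} \<in> edges (paley_hypergraph k R)})}
    = lift ` {u \<in> V \<rightarrow>\<^sub>E UNIV. inj_on u V \<and>
        even (card {\<epsilon> \<in> {1..k} \<rightarrow>\<^sub>E UNIV. \<exists>y. face_sum {1..k} u \<epsilon> = y ^ 2})}"
    unfolding lift_range[symmetric] by (auto simp: lift_inj_on edge simp del: One_nat_def)
  also have "card \<dots> = card {u \<in> V \<rightarrow>\<^sub>E (UNIV::'b set). inj_on u V \<and>
        even (card {\<epsilon> \<in> {1..k} \<rightarrow>\<^sub>E UNIV. \<exists>y. face_sum {1..k} u \<epsilon> = y ^ 2})}"
    by (rule card_image) (rule inj_on_subset[OF inj_lift], auto)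
  finally show ?thesis .
qed

section \<open>From type classes to all finite fields over a type\<close>

text \<open>A prime field, transported along an injection of the residues into the infinite type.\<close>
lemma ex_odd_finite_field:
  "\<exists>(R :: 'a::infinite ring) q. odd_finite_field q R \<and> n < q"
proof -
  obtain p :: nat where p: "prime p" "n + 2 < p" using bigger_prime by blast
  interpret residues_prime p "residue_ring (int p)"
    by unfold_locales (use p in auto)
  obtain e :: "nat \<Rightarrow> 'a" where e: "inj e"
    using infinite_countable_subset[OF infinite_UNIV] by blast
  define \<iota> where "\<iota> = e \<circ> nat"
  have carrier: "carrier (residue_ring (int p)) = {0..int p - 1}"
    by (simp add: residue_ring_def)
  have inj: "inj_on \<iota> (carrier (residue_ring (int p)))"
  proof (rule inj_onI)
    fix x y assume xy: "x \<in> carrier (residue_ring (int p))" "y \<in> carrier (residue_ring (int p))"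
      and "\<iota> x = \<iota> y"
    then have "nat x = nat y" using injD[OF e] by (simp add: \<iota>_def)
    then show "x = y" using xy by (auto simp: carrier eq_nat_nat_iff)
  qed
  have "field (image_ring \<iota> (residue_ring (int p)))"
    using field.inj_imp_image_ring_is_field[OF is_field inj] .
  moreover have "Coset.order (image_ring \<iota> (residue_ring (int p))) = p"
    using card_image[OF inj] by (simp add: Coset.order_def image_ring_carrier carrier)
  moreover have "odd p" using p prime_odd_nat by simp
  ultimately have "odd_finite_field p (image_ring \<iota> (residue_ring (int p)))"
    using p(1) by (simp add: odd_finite_field_def)
  then show ?thesis using p(2) by (meson add_lessD1)
qed

definition epo_bound :: "'a ring \<Rightarrow> bool" where
  "epo_bound R \<longleftrightarrow> (\<forall>k\<ge>2. \<bar>real (epo_count k (paley_hypergraph k R)) - real (Coset.order R) ^ (2 * k) / 2\<bar>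
      \<le> epo_constant k * real (Coset.order R) ^ (2 * k - 1))"

text \<open>
  A type of class \<^class>\<open>finite_field\<close> can be made from the carrier of one fixed record, but not from a record that
  is a variable of a theorem. This record is a potential counterexample: if some field violates
  the bound, then this one does, so a proof for this single field covers all of them.
\<close>
definition test_field :: "'a::infinite ring" where
  "test_field = (SOME R. odd_finite_field (Coset.order R) R \<and>
      ((\<exists>S::'a ring. odd_finite_field (Coset.order S) S \<and> \<not> epo_bound S) \<longrightarrow> \<not> epo_bound R))"

lemma test_field:
  "odd_finite_field (Coset.order (test_field :: 'a::infinite ring)) (test_field :: 'a ring)"
  "odd_finite_field q (S :: 'a ring) \<Longrightarrow> epo_bound (test_field :: 'a ring) \<Longrightarrow> epo_bound S"
proof -
  let ?P = "\<lambda>R::'a ring. odd_finite_field (Coset.order R) R \<and>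
      ((\<exists>S::'a ring. odd_finite_field (Coset.order S) S \<and> \<not> epo_bound S) \<longrightarrow> \<not> epo_bound R)"
  have "\<exists>R::'a ring. odd_finite_field (Coset.order R) R"
    using ex_odd_finite_field[where 'a = 'a] by (metis odd_finite_field_def)
  then have "\<exists>R. ?P R" by blast
  then have "?P test_field" unfolding test_field_def by (rule someI_ex)
  then show "odd_finite_field (Coset.order (test_field :: 'a ring)) (test_field :: 'a ring)"
    "odd_finite_field q (S :: 'a ring) \<Longrightarrow> epo_bound (test_field :: 'a ring) \<Longrightarrow> epo_bound S"
    by (auto simp: odd_finite_field_def)
qed

lemma field_test_field: "field (test_field :: 'a::infinite ring)"
  using test_field(1)[where 'a = 'a] unfolding odd_finite_field_def by blast

typedef (overloaded) ('a::infinite) test_elem = "carrier (test_field :: 'a ring)"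
proof -
  interpret field "test_field :: 'a ring" by (rule field_test_field)
  show ?thesis using zero_closed by blast
qed

instantiation test_elem :: (infinite) field
begin

definition "0 = Abs_test_elem \<zero>\<^bsub>test_field\<^esub>"
definition "1 = Abs_test_elem \<one>\<^bsub>test_field\<^esub>"
definition "x + y = Abs_test_elem (Rep_test_elem x \<oplus>\<^bsub>test_field\<^esub> Rep_test_elem y)"
definition "x * y = Abs_test_elem (Rep_test_elem x \<otimes>\<^bsub>test_field\<^esub> Rep_test_elem y)"
definition "- x = Abs_test_elem (\<ominus>\<^bsub>test_field\<^esub> Rep_test_elem x)"
definition "x - y = x + (- y :: 'a test_elem)"
definition "inverse x = (if x = 0 then 0 else Abs_test_elem (inv\<^bsub>test_field\<^esub> Rep_test_elem x))"
definition "x div y = x * (inverse y :: 'a test_elem)"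

instance
proof
  interpret field "test_field :: 'a ring" by (rule field_test_field)
  note [simp] = Rep_test_elem[where 'a = 'a]
  have Rep_0: "Rep_test_elem (0 :: 'a test_elem) = \<zero>\<^bsub>test_field\<^esub>"
    and Rep_1: "Rep_test_elem (1 :: 'a test_elem) = \<one>\<^bsub>test_field\<^esub>"
    and Rep_add: "Rep_test_elem (x + y) = Rep_test_elem x \<oplus>\<^bsub>test_field\<^esub> Rep_test_elem y"
    and Rep_mult: "Rep_test_elem (x * y) = Rep_test_elem x \<otimes>\<^bsub>test_field\<^esub> Rep_test_elem y"
    and Rep_minus: "Rep_test_elem (- x) = \<ominus>\<^bsub>test_field\<^esub> Rep_test_elem x"
    for x y :: "'a test_elem"
    by (simp_all add: zero_test_elem_def one_test_elem_def plus_test_elem_def times_test_elem_def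
        uminus_test_elem_def Abs_test_elem_inverse)
  note Rep = Rep_0 Rep_1 Rep_add Rep_mult Rep_minus
  have Rep_inverse: "Rep_test_elem (inverse x) = inv\<^bsub>test_field\<^esub> Rep_test_elem x"
    and nonzero: "Rep_test_elem x \<in> Units test_field" if "x \<noteq> 0" for x :: "'a test_elem"
  proof -
    have "Rep_test_elem x \<noteq> \<zero>\<^bsub>test_field\<^esub>" using that by (metis Rep_0 Rep_test_elem_inject)
    then show unit: "Rep_test_elem x \<in> Units test_field" by (simp add: field_Units)
    show "Rep_test_elem (inverse x) = inv\<^bsub>test_field\<^esub> Rep_test_elem x"
      using that Units_inv_closed[OF unit] by (simp add: inverse_test_elem_def Abs_test_elem_inverse)
  qed
  fix a b c :: "'a test_elem"
  show "a * b * c = a * (b * c)" "a * b = b * a" "1 * a = a" "a + b + c = a + (b + c)"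
    "a + b = b + a" "0 + a = a" "- a + a = 0" "(a + b) * c = a * c + b * c"
    by (simp_all add: Rep_test_elem_inject[symmetric] Rep m_ac a_ac l_distr r_distr r_neg)
  show "a - b = a + - b" by (simp add: minus_test_elem_def)
  show "(0 :: 'a test_elem) \<noteq> 1" by (simp add: Rep_test_elem_inject[symmetric] Rep)
  show "inverse a * a = 1" if "a \<noteq> 0"
    using that nonzero by (simp add: Rep_test_elem_inject[symmetric] Rep Rep_inverse)
  show "a div b = a * inverse b" by (simp add: divide_test_elem_def)
  show "inverse 0 = (0 :: 'a test_elem)" by (simp add: inverse_test_elem_def)
qed

end

lemma card_test_elem: "CARD('a::infinite test_elem) = Coset.order (test_field :: 'a ring)"
  by (simp add: type_definition.card[OF type_definition_test_elem] Coset.order_def)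

instance test_elem :: (infinite) finite_field
proof (rule finite_fieldI)
  have "CARD('a test_elem) > 0"
    using test_field(1)[where 'a = 'a] by (simp add: card_test_elem odd_finite_field_def primepow_gt_0_nat)
  then show "finite (UNIV :: 'a test_elem set)" by (rule card_ge_0_finite)
qed

lemma epo_bound_test_field: "epo_bound (test_field :: 'a::infinite ring)"
  unfolding epo_bound_def
proof (intro allI impI)
  fix k :: nat assume k: "2 \<le> k"
  define q where "q = Coset.order (test_field :: 'a ring)"
  have q: "q = CARD('a test_elem)" "odd q" "primepow q" and R: "field (test_field :: 'a ring)"
    using test_field(1)[where 'a = 'a] by (auto simp: q_def odd_finite_field_def card_test_elem)
  interpret field "test_field :: 'a ring" by (rule R)
  have "bij_betw Rep_test_elem UNIV (carrier (test_field :: 'a ring))"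
    by (intro bij_betw_imageI inj_onI)
      (auto simp: Rep_test_elem_inject type_definition.Rep_range[OF type_definition_test_elem])
  then have epo: "epo_count k (paley_hypergraph k (test_field :: 'a ring))
      = card {u \<in> {1..k} \<times> UNIV \<rightarrow>\<^sub>E (UNIV::'a test_elem set). inj_on u ({1..k} \<times> UNIV) \<and>
          even (card {\<epsilon> \<in> {1..k} \<rightarrow>\<^sub>E UNIV. \<exists>y. face_sum {1..k} u \<epsilon> = y ^ 2})}"
    by (rule epo_count_paley_hypergraph[OF R])
      (simp_all only: plus_test_elem_def times_test_elem_def
        Abs_test_elem_inverse[OF a_closed[OF Rep_test_elem Rep_test_elem]]
        Abs_test_elem_inverse[OF m_closed[OF Rep_test_elem Rep_test_elem]])
  show "\<bar>real (epo_count k (paley_hypergraph k (test_field :: 'a ring)))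
        - real (Coset.order (test_field :: 'a ring)) ^ (2 * k) / 2\<bar>
      \<le> epo_constant k * real (Coset.order (test_field :: 'a ring)) ^ (2 * k - 1)"
    using even_square_faces_count[OF q, of "{1..k}"] k unfolding epo q_def[symmetric] by simp
qed

lemma epo_count_paley_bound:
  assumes "odd_finite_field q (R :: 'a::infinite ring)" "k \<ge> 2"
  shows "\<bar>real (epo_count k (paley_hypergraph k R)) - real q ^ (2 * k) / 2\<bar>
      \<le> epo_constant k * real q ^ (2 * k - 1)"
  using test_field(2)[OF assms(1) epo_bound_test_field] assms
  by (simp add: epo_bound_def odd_finite_field_def)

section \<open>The Paley hypergraphs are quasi-random\<close>
theorem corollary1p4:
  fixes k :: nat
  assumes "k \<ge> 2"
  shows "(\<exists>C::real. \<forall>q. \<forall>R :: 'a::infinite ring. odd_finite_field q R \<longrightarrow>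
            \<bar>real (epo_count k (paley_hypergraph k R)) - real q ^ (2 * k) / 2\<bar>
              \<le> C * real q ^ (2 * k - 1)) \<and>
         quasi_random k {paley_hypergraph k R | (R :: 'a ring) q. odd_finite_field q R}"
proof
  show "\<exists>C::real. \<forall>q. \<forall>R :: 'a::infinite ring. odd_finite_field q R \<longrightarrow>
            \<bar>real (epo_count k (paley_hypergraph k R)) - real q ^ (2 * k) / 2\<bar>
              \<le> C * real q ^ (2 * k - 1)"
    using epo_count_paley_bound assms by blast
  define \<delta> where "\<delta> = (\<lambda>n::nat. 2 * epo_constant k / real n)"
  have card: "card (verts (paley_hypergraph k R)) = q" "finite (carrier R)" "q > 0"
    if "odd_finite_field q R" for q and R :: "'a ring"
  proof -
    show "q > 0" using that by (auto simp: odd_finite_field_def primepow_gt_0_nat)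
    then show "card (verts (paley_hypergraph k R)) = q" "finite (carrier R)"
      using that by (auto simp: odd_finite_field_def paley_hypergraph_def Coset.order_def card_gt_0_iff)
  qed
  have upper: "real (epo_count k (paley_hypergraph k R)) \<le> (1 + \<delta> q) * (real q ^ (2 * k) / 2)"
    if R: "odd_finite_field q R" for q and R :: "'a ring"
  proof -
    have "real q ^ (2 * k) = real q * real q ^ (2 * k - 1)"
      using assms by (simp flip: power_Suc)
    then have "(1 + \<delta> q) * (real q ^ (2 * k) / 2)
        = real q ^ (2 * k) / 2 + epo_constant k * real q ^ (2 * k - 1)"
      using card(3)[OF R] by (simp add: \<delta>_def field_simps)
    then show ?thesis using epo_count_paley_bound[OF R assms] by linarith
  qed
  show "quasi_random k {paley_hypergraph k R | (R :: 'a ring) q. odd_finite_field q R}"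
    unfolding quasi_random_def
  proof (intro conjI exI[of _ \<delta>])
    show "\<forall>G\<in>{paley_hypergraph k R | (R :: 'a ring) q. odd_finite_field q R}. uniform_hypergraph k G"
      using card(2) by (auto simp: uniform_hypergraph_def paley_hypergraph_def)
    show "\<forall>n. \<exists>G\<in>{paley_hypergraph k R | (R :: 'a ring) q. odd_finite_field q R}. n < card (verts G)"
    proof
      fix n
      obtain R :: "'a ring" and q where R: "odd_finite_field q R" "n < q"
        using ex_odd_finite_field by blast
      then show "\<exists>G\<in>{paley_hypergraph k R | (R :: 'a ring) q. odd_finite_field q R}. n < card (verts G)"
        using card(1)[OF R(1)] by auto
    qed
    show "\<delta> \<longlonglongrightarrow> 0" unfolding \<delta>_def by (rule lim_const_over_n)
    show "\<forall>G\<in>{paley_hypergraph k R | (R :: 'a ring) q. odd_finite_field q R}.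
        real (epo_count k G) \<le> (1 + \<delta> (card (verts G))) * (real (card (verts G)) ^ (2 * k) / 2)"
      using upper card(1) by auto
  qed
qed

end
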